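(* Let $(\mathcal{C},\mathcal{E})$ be an exact category with enough $\mathcal{E}$-projectives, which is weakly idempotent complete, and let $\mathcal{A}:={}^{{}_{\mathcal{E}}\perp}\mathcal{P}(\mathcal{E})$. Then the restriction $\Omega_{\mathcal{E}}:\underline{\mathcal{A}}\to\underline{\mathcal{A}}$ of the syzygy functor $\Omega_{\mathcal{E}}:\underline{\mathcal{C}}\to\underline{\mathcal{C}}$ is full and faithful.
   Context: $(\mathcal{C},\mathcal{E})$ is an exact category in the sense of Quillen: $\mathcal{C}$ is additive and $\mathcal{E}$ is a class of kernel-cokernel pairs (short $\mathcal{E}$-exact sequences) $A'\rightarrowtail A\twoheadrightarrow A''$ satisfying the usual axioms; the second maps are the admissible epics. An object $P$ is $\mathcal{E}$-projective if $\mathrm{Hom}_{\mathcal{C}}(P,-)$ takes short $\mathcal{E}$-exact sequences to short exact sequences of abelian groups; $\mathcal{P}(\mathcal{E})$ is the class of these. Enough $\mathcal{E}$-projectives: every $C$ admits an admissible epic $P\twoheadrightarrow C$ with $P\in\mathcal{P}(\mathcal{E})$. $\mathrm{Ext}^n_{\mathcal{E}}(C,B)$ is the $n$-th cohomology of $\mathrm{Hom}_{\mathcal{C}}(P_\bullet(C),B)$, with $P_\bullet(C)$ an $\mathcal{E}$-projective resolution of $C$ (a resolution by $\mathcal{E}$-projectives spliced from short $\mathcal{E}$-exact sequences). The category $\mathcal{C}$ is weakly idempotent complete if every split monomorphism in $\mathcal{C}$ has a cokernel. For a class $\mathcal{Y}$ of objects, ${}^{{}_{\mathcal{E}}\perp}\mathcal{Y}$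 is the full subcategory of all $M\in\mathcal{C}$ with $\mathrm{Ext}^i_{\mathcal{E}}(M,Y)=0$ for all $Y\in\mathcal{Y}$ and $i\ge1$. The stable category $\underline{\mathcal{C}}$ has the objects of $\mathcal{C}$, and its morphisms are those of $\mathcal{C}$ modulo morphisms factoring through an object of $\mathcal{P}(\mathcal{E})$; $\underline{\mathcal{A}}$ is its full subcategory on the objects of $\mathcal{A}$. For each $M$ choose a short $\mathcal{E}$-exact sequence $\Omega_{\mathcal{E}}(M)\rightarrowtail P\twoheadrightarrow M$ with $P\in\mathcal{P}(\mathcal{E})$; lifting a morphism $f:M\to M'$ to these sequences gives $f_1:\Omega_{\mathcal{E}}(M)\to\Omega_{\mathcal{E}}(M')$, and $[f]\mapsto[f_1]$ defines the additive syzygy functor $\Omega_{\mathcal{E}}:\underline{\mathcal{C}}\to\underline{\mathcal{C}}$. (Part of the assertion is that it maps $\underline{\mathcal{A}}$ into itself.) *)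

theory Defs
  imports "HOL-Algebra.Exact_Sequence"
begin

section \<open>Preadditive and additive categories\<close>

text \<open>
  Every arrow has one domain and one codomain, so distinct Hom-sets are disjoint.
  The composite \<open>g \<cdot> f\<close> is ``first \<open>f\<close>, then \<open>g\<close>''.
  Operations are only meaningful on composable, respectively parallel, arrows.
\<close>

record ('o, 'm) preadd_cat =
  Obj  :: "'o set"
  Arr  :: "'m set"
  Dom  :: "'m \<Rightarrow> 'o"
  Cod  :: "'m \<Rightarrow> 'o"
  Id   :: "'o \<Rightarrow> 'm"
  Comp :: "'m \<Rightarrow> 'm \<Rightarrow> 'm"  (infixl "\<cdot>\<index>" 70)
  Plus :: "'m \<Rightarrow> 'm \<Rightarrow> 'm"  (infixl "\<boxplus>\<index>" 65)
  Null :: "'o \<Rightarrow> 'o \<Rightarrow> 'm"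

definition Hom :: "('o, 'm) preadd_cat \<Rightarrow> 'o \<Rightarrow> 'o \<Rightarrow> 'm set"
  where "Hom C a b = {f \<in> Arr C. Dom C f = a \<and> Cod C f = b}"

definition hom_group :: "('o, 'm) preadd_cat \<Rightarrow> 'o \<Rightarrow> 'o \<Rightarrow> 'm monoid"
  where "hom_group C a b = \<lparr>carrier = Hom C a b, mult = Plus C, one = Null C a b\<rparr>"

locale preadditive_category =
  fixes C :: "('o, 'm) preadd_cat" (structure)
  assumes dom_obj: "f \<in> Arr C \<Longrightarrow> Dom C f \<in> Obj C"
    and cod_obj: "f \<in> Arr C \<Longrightarrow> Cod C f \<in> Obj C"
    and id_hom: "a \<in> Obj C \<Longrightarrow> Id C a \<in> Hom C a a"
    and comp_hom: "\<lbrakk>f \<in> Hom C a b; g \<in> Hom C b c\<rbrakk> \<Longrightarrow> g \<cdot> f \<in> Hom C a c"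
    and comp_id_right: "f \<in> Hom C a b \<Longrightarrow> f \<cdot> Id C a = f"
    and comp_id_left: "f \<in> Hom C a b \<Longrightarrow> Id C b \<cdot> f = f"
    and comp_assoc: "\<lbrakk>f \<in> Hom C a b; g \<in> Hom C b c; h \<in> Hom C c d\<rbrakk>
                     \<Longrightarrow> (h \<cdot> g) \<cdot> f = h \<cdot> (g \<cdot> f)"
    and hom_comm_group: "\<lbrakk>a \<in> Obj C; b \<in> Obj C\<rbrakk> \<Longrightarrow> comm_group (hom_group C a b)"
    and comp_plus_right: "\<lbrakk>f \<in> Hom C a b; f' \<in> Hom C a b; g \<in> Hom C b c\<rbrakk>
                     \<Longrightarrow> g \<cdot> (f \<boxplus> f') = g \<cdot> f \<boxplus> g \<cdot> f'"
    and comp_plus_left: "\<lbrakk>f \<in> Hom C a b; g \<in> Hom C b c; g' \<in> Hom C b c\<rbrakk>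
                     \<Longrightarrow> (g \<boxplus> g') \<cdot> f = g \<cdot> f \<boxplus> g' \<cdot> f"

definition is_zero_object :: "('o, 'm) preadd_cat \<Rightarrow> 'o \<Rightarrow> bool"
  where "is_zero_object C z \<longleftrightarrow> z \<in> Obj C \<and>
    (\<forall>a \<in> Obj C. (\<exists>!f. f \<in> Hom C a z) \<and> (\<exists>!f. f \<in> Hom C z a))"

definition is_biproduct ::
  "('o, 'm) preadd_cat \<Rightarrow> 'o \<Rightarrow> 'o \<Rightarrow> 'o \<Rightarrow> 'm \<Rightarrow> 'm \<Rightarrow> 'm \<Rightarrow> 'm \<Rightarrow> bool"
  where "is_biproduct C a b s i j p q \<longleftrightarrow>
    i \<in> Hom C a s \<and> j \<in> Hom C b s \<and> p \<in> Hom C s a \<and> q \<in> Hom C s b \<and>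
    p \<cdot>\<^bsub>C\<^esub> i = Id C a \<and> q \<cdot>\<^bsub>C\<^esub> j = Id C b \<and>
    q \<cdot>\<^bsub>C\<^esub> i = Null C a b \<and> p \<cdot>\<^bsub>C\<^esub> j = Null C b a \<and>
    i \<cdot>\<^bsub>C\<^esub> p \<boxplus>\<^bsub>C\<^esub> j \<cdot>\<^bsub>C\<^esub> q = Id C s"

locale additive_category = preadditive_category +
  assumes zero_object: "\<exists>z. is_zero_object C z"
    and biproducts: "\<lbrakk>a \<in> Obj C; b \<in> Obj C\<rbrakk> \<Longrightarrow> \<exists>s i j p q. is_biproduct C a b s i j p q"

section \<open>Exact categories\<close>

definition is_kernel :: "('o, 'm) preadd_cat \<Rightarrow> 'm \<Rightarrow> 'm \<Rightarrow> bool"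
  where "is_kernel C i p \<longleftrightarrow> i \<in> Arr C \<and> p \<in> Arr C \<and> Cod C i = Dom C p \<and>
    p \<cdot>\<^bsub>C\<^esub> i = Null C (Dom C i) (Cod C p) \<and>
    (\<forall>f \<in> Arr C. Cod C f = Dom C p \<and> p \<cdot>\<^bsub>C\<^esub> f = Null C (Dom C f) (Cod C p) \<longrightarrow>
       (\<exists>!g. g \<in> Hom C (Dom C f) (Dom C i) \<and> i \<cdot>\<^bsub>C\<^esub> g = f))"

definition is_cokernel :: "('o, 'm) preadd_cat \<Rightarrow> 'm \<Rightarrow> 'm \<Rightarrow> bool"
  where "is_cokernel C p i \<longleftrightarrow> i \<in> Arr C \<and> p \<in> Arr C \<and> Cod C i = Dom C p \<and>
    p \<cdot>\<^bsub>C\<^esub> i = Null C (Dom C i) (Cod C p) \<and>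
    (\<forall>f \<in> Arr C. Dom C f = Cod C i \<and> f \<cdot>\<^bsub>C\<^esub> i = Null C (Dom C i) (Cod C f) \<longrightarrow>
       (\<exists>!g. g \<in> Hom C (Cod C p) (Cod C f) \<and> g \<cdot>\<^bsub>C\<^esub> p = f))"

definition is_iso :: "('o, 'm) preadd_cat \<Rightarrow> 'm \<Rightarrow> bool"
  where "is_iso C f \<longleftrightarrow> f \<in> Arr C \<and>
    (\<exists>g \<in> Hom C (Cod C f) (Dom C f).
       g \<cdot>\<^bsub>C\<^esub> f = Id C (Dom C f) \<and> f \<cdot>\<^bsub>C\<^esub> g = Id C (Cod C f))"

text \<open>The square \<open>g' \<cdot> f = f' \<cdot> g\<close>, with \<open>f'\<close> opposite to \<open>f\<close> and \<open>g'\<close> opposite to \<open>g\<close>.\<close>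

definition is_pushout :: "('o, 'm) preadd_cat \<Rightarrow> 'm \<Rightarrow> 'm \<Rightarrow> 'm \<Rightarrow> 'm \<Rightarrow> bool"
  where "is_pushout C f g f' g' \<longleftrightarrow>
    f \<in> Arr C \<and> g \<in> Arr C \<and> f' \<in> Arr C \<and> g' \<in> Arr C \<and>
    Dom C f = Dom C g \<and> Dom C f' = Cod C g \<and> Dom C g' = Cod C f \<and> Cod C f' = Cod C g' \<and>
    g' \<cdot>\<^bsub>C\<^esub> f = f' \<cdot>\<^bsub>C\<^esub> g \<and>
    (\<forall>x \<in> Obj C. \<forall>u \<in> Hom C (Cod C f) x. \<forall>v \<in> Hom C (Cod C g) x.
       u \<cdot>\<^bsub>C\<^esub> f = v \<cdot>\<^bsub>C\<^esub> g \<longrightarrow>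
       (\<exists>!w. w \<in> Hom C (Cod C f') x \<and> w \<cdot>\<^bsub>C\<^esub> g' = u \<and> w \<cdot>\<^bsub>C\<^esub> f' = v))"

text \<open>The square \<open>f \<cdot> g' = g \<cdot> f'\<close>, with \<open>f'\<close> opposite to \<open>f\<close> and \<open>g'\<close> opposite to \<open>g\<close>.\<close>

definition is_pullback :: "('o, 'm) preadd_cat \<Rightarrow> 'm \<Rightarrow> 'm \<Rightarrow> 'm \<Rightarrow> 'm \<Rightarrow> bool"
  where "is_pullback C f g f' g' \<longleftrightarrow>
    f \<in> Arr C \<and> g \<in> Arr C \<and> f' \<in> Arr C \<and> g' \<in> Arr C \<and>
    Cod C f = Cod C g \<and> Cod C f' = Dom C g \<and> Cod C g' = Dom C f \<and> Dom C f' = Dom C g' \<and>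
    f \<cdot>\<^bsub>C\<^esub> g' = g \<cdot>\<^bsub>C\<^esub> f' \<and>
    (\<forall>x \<in> Obj C. \<forall>u \<in> Hom C x (Dom C f). \<forall>v \<in> Hom C x (Dom C g).
       f \<cdot>\<^bsub>C\<^esub> u = g \<cdot>\<^bsub>C\<^esub> v \<longrightarrow>
       (\<exists>!w. w \<in> Hom C x (Dom C f') \<and> g' \<cdot>\<^bsub>C\<^esub> w = u \<and> f' \<cdot>\<^bsub>C\<^esub> w = v))"

text \<open>
  A pair \<open>(i, p) \<in> E\<close> is a short exact sequence with admissible monic \<open>i\<close> and admissible
  epic \<open>p\<close>.  The axioms are Quillen's in the self-dual form of Keller and Buehler.
  Since \<open>E\<close> is closed under isomorphism, asking for one pushout (pullback) with the
  required property is the same as asking it of every one.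
\<close>

definition adm_monics :: "('m \<times> 'm) set \<Rightarrow> 'm set"
  where "adm_monics E = fst ` E"

definition adm_epics :: "('m \<times> 'm) set \<Rightarrow> 'm set"
  where "adm_epics E = snd ` E"

locale exact_category = additive_category +
  fixes E :: "('b \<times> 'b) set"
  assumes kernel_cokernel_pair: "(i, p) \<in> E \<Longrightarrow> is_kernel C i p \<and> is_cokernel C p i"
    and iso_closed:
      "\<lbrakk>(i, p) \<in> E; i' \<in> Arr C; p' \<in> Arr C; Cod C i' = Dom C p';
        is_iso C a; a \<in> Hom C (Dom C i) (Dom C i');
        is_iso C b; b \<in> Hom C (Cod C i) (Cod C i');
        is_iso C c; c \<in> Hom C (Cod C p) (Cod C p');
        b \<cdot> i = i' \<cdot> a; c \<cdot> p = p' \<cdot> b\<rbrakk> \<Longrightarrow> (i', p') \<in> E"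
    and id_adm_monic: "x \<in> Obj C \<Longrightarrow> Id C x \<in> adm_monics E"
    and id_adm_epic: "x \<in> Obj C \<Longrightarrow> Id C x \<in> adm_epics E"
    and comp_adm_monic:
      "\<lbrakk>i \<in> adm_monics E; j \<in> adm_monics E; Cod C i = Dom C j\<rbrakk> \<Longrightarrow> j \<cdot> i \<in> adm_monics E"
    and comp_adm_epic:
      "\<lbrakk>p \<in> adm_epics E; q \<in> adm_epics E; Cod C p = Dom C q\<rbrakk> \<Longrightarrow> q \<cdot> p \<in> adm_epics E"
    and pushout_adm_monic:
      "\<lbrakk>i \<in> adm_monics E; g \<in> Arr C; Dom C g = Dom C i\<rbrakk>
       \<Longrightarrow> \<exists>i' g'. is_pushout C i g i' g' \<and> i' \<in> adm_monics E"
    and pullback_adm_epic: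
      "\<lbrakk>p \<in> adm_epics E; g \<in> Arr C; Cod C g = Cod C p\<rbrakk>
       \<Longrightarrow> \<exists>p' g'. is_pullback C p g p' g' \<and> p' \<in> adm_epics E"

definition weakly_idempotent_complete :: "('o, 'm) preadd_cat \<Rightarrow> bool"
  where "weakly_idempotent_complete C \<longleftrightarrow>
    (\<forall>f \<in> Arr C. (\<exists>r \<in> Hom C (Cod C f) (Dom C f). r \<cdot>\<^bsub>C\<^esub> f = Id C (Dom C f))
       \<longrightarrow> (\<exists>p. is_cokernel C p f))"

section \<open>Projectives, resolutions and Ext\<close>

definition projectives :: "('o, 'm) preadd_cat \<Rightarrow> ('m \<times> 'm) set \<Rightarrow> 'o set"
  where "projectives C E = {P \<in> Obj C. \<forall>(i, p) \<in> E.
    exact_seq ([hom_group C P (Cod C p), hom_group C P (Dom C p), hom_group C P (Dom C i)],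
               [\<lambda>f. p \<cdot>\<^bsub>C\<^esub> f, \<lambda>f. i \<cdot>\<^bsub>C\<^esub> f]) \<and>
    inj_on (\<lambda>f. i \<cdot>\<^bsub>C\<^esub> f) (Hom C P (Dom C i)) \<and>
    (\<lambda>f. p \<cdot>\<^bsub>C\<^esub> f) ` Hom C P (Dom C p) = Hom C P (Cod C p)}"

definition enough_projectives :: "('o, 'm) preadd_cat \<Rightarrow> ('m \<times> 'm) set \<Rightarrow> bool"
  where "enough_projectives C E \<longleftrightarrow>
    (\<forall>x \<in> Obj C. \<exists>p \<in> adm_epics E. Dom C p \<in> projectives C E \<and> Cod C p = x)"

text \<open>
  A projective resolution is given by the short exact sequences it is spliced from:
  \<open>R n = (i\<^sub>n, p\<^sub>n)\<close> is \<open>Z (n+1) \<rightarrow> P n \<rightarrow> Z n\<close> with \<open>Z 0 = M\<close>, and the differential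
  \<open>P (n+1) \<rightarrow> P n\<close> is \<open>i\<^sub>n \<cdot> p\<^sub>n\<^sub>+\<^sub>1\<close>.
\<close>

definition proj_resolution ::
  "('o, 'm) preadd_cat \<Rightarrow> ('m \<times> 'm) set \<Rightarrow> 'o \<Rightarrow> (nat \<Rightarrow> 'm \<times> 'm) \<Rightarrow> bool"
  where "proj_resolution C E M R \<longleftrightarrow>
    Cod C (snd (R 0)) = M \<and>
    (\<forall>n. R n \<in> E \<and> Dom C (snd (R n)) \<in> projectives C E \<and>
         Cod C (snd (R (Suc n))) = Dom C (fst (R n)))"

definition the_resolution :: "('o, 'm) preadd_cat \<Rightarrow> ('m \<times> 'm) set \<Rightarrow> 'o \<Rightarrow> nat \<Rightarrow> 'm \<times> 'm"
  where "the_resolution C E M = (SOME R. proj_resolution C E M R)"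

definition cochain_group ::
  "('o, 'm) preadd_cat \<Rightarrow> (nat \<Rightarrow> 'm \<times> 'm) \<Rightarrow> 'o \<Rightarrow> nat \<Rightarrow> 'm monoid"
  where "cochain_group C R B n = hom_group C (Dom C (snd (R n))) B"

definition codiff :: "('o, 'm) preadd_cat \<Rightarrow> (nat \<Rightarrow> 'm \<times> 'm) \<Rightarrow> nat \<Rightarrow> 'm \<Rightarrow> 'm"
  where "codiff C R n f = f \<cdot>\<^bsub>C\<^esub> (fst (R n) \<cdot>\<^bsub>C\<^esub> snd (R (Suc n)))"

definition cocycles ::
  "('o, 'm) preadd_cat \<Rightarrow> (nat \<Rightarrow> 'm \<times> 'm) \<Rightarrow> 'o \<Rightarrow> nat \<Rightarrow> 'm set"
  where "cocycles C R B n =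
    kernel (cochain_group C R B n) (cochain_group C R B (Suc n)) (codiff C R n)"

fun coboundaries ::
  "('o, 'm) preadd_cat \<Rightarrow> (nat \<Rightarrow> 'm \<times> 'm) \<Rightarrow> 'o \<Rightarrow> nat \<Rightarrow> 'm set"
  where
    "coboundaries C R B 0 = {\<one>\<^bsub>cochain_group C R B 0\<^esub>}"
  | "coboundaries C R B (Suc n) = codiff C R n ` carrier (cochain_group C R B n)"

definition Ext ::
  "('o, 'm) preadd_cat \<Rightarrow> ('m \<times> 'm) set \<Rightarrow> nat \<Rightarrow> 'o \<Rightarrow> 'o \<Rightarrow> 'm set monoid"
  where "Ext C E n M B = (let R = the_resolution C E M in
    cochain_group C R B n \<lparr>carrier := cocycles C R B n\<rparr> Mod coboundaries C R B n)"

definition left_perp :: "('o, 'm) preadd_cat \<Rightarrow> ('m \<times> 'm) set \<Rightarrow> 'o set \<Rightarrow> 'o set"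
  where "left_perp C E Y =
    {M \<in> Obj C. \<forall>y \<in> Y. \<forall>n \<ge> 1. trivial_group (Ext C E n M y)}"

section \<open>The stable category\<close>

definition proj_factoring :: "('o, 'm) preadd_cat \<Rightarrow> ('m \<times> 'm) set \<Rightarrow> 'o \<Rightarrow> 'o \<Rightarrow> 'm set"
  where "proj_factoring C E a b =
    {h \<cdot>\<^bsub>C\<^esub> g | g h. \<exists>Q \<in> projectives C E. g \<in> Hom C a Q \<and> h \<in> Hom C Q b}"

definition stable_class :: "('o, 'm) preadd_cat \<Rightarrow> ('m \<times> 'm) set \<Rightarrow> 'm \<Rightarrow> 'm set"
  where "stable_class C E f =
    proj_factoring C E (Dom C f) (Cod C f) #>\<^bsub>hom_group C (Dom C f) (Cod C f)\<^esub> f"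

definition rep :: "'m set \<Rightarrow> 'm"
  where "rep F = (SOME f. f \<in> F)"

text \<open>
  The arrows are the cosets \<open>stable_class C E f\<close>, so the Hom-group from \<open>a\<close> to \<open>b\<close> is
  \<open>hom_group C a b Mod proj_factoring C E a b\<close>.
\<close>

definition stable_category ::
  "('o, 'm) preadd_cat \<Rightarrow> ('m \<times> 'm) set \<Rightarrow> ('o, 'm set) preadd_cat"
  where "stable_category C E =
    \<lparr>Obj = Obj C,
     Arr = stable_class C E ` Arr C,
     Dom = (\<lambda>F. Dom C (rep F)),
     Cod = (\<lambda>F. Cod C (rep F)),
     Id = (\<lambda>a. stable_class C E (Id C a)),
     Comp = (\<lambda>G F. stable_class C E (rep G \<cdot>\<^bsub>C\<^esub> rep F)),
     Plus = (\<lambda>F G. {f \<boxplus>\<^bsub>C\<^esub> g | f g. f \<in> F \<and> g \<in> G}),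
     Null = (\<lambda>a b. proj_factoring C E a b)\<rparr>"

definition full_subcategory :: "('o, 'm) preadd_cat \<Rightarrow> 'o set \<Rightarrow> ('o, 'm) preadd_cat"
  where "full_subcategory C S = C
    \<lparr>Obj := Obj C \<inter> S, Arr := {f \<in> Arr C. Dom C f \<in> S \<and> Cod C f \<in> S}\<rparr>"

section \<open>The syzygy functor\<close>

text \<open>\<open>S M\<close> is the chosen short exact sequence from the syzygy of \<open>M\<close> to \<open>M\<close>.\<close>

definition syzygy_choice ::
  "('o, 'm) preadd_cat \<Rightarrow> ('m \<times> 'm) set \<Rightarrow> ('o \<Rightarrow> 'm \<times> 'm) \<Rightarrow> bool"
  where "syzygy_choice C E S \<longleftrightarrow>
    (\<forall>M \<in> Obj C. S M \<in> E \<and> Dom C (snd (S M)) \<in> projectives C E \<and> Cod C (snd (S M)) = M)"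

definition syzygy_obj :: "('o, 'm) preadd_cat \<Rightarrow> ('o \<Rightarrow> 'm \<times> 'm) \<Rightarrow> 'o \<Rightarrow> 'o"
  where "syzygy_obj C S M = Dom C (fst (S M))"

definition syzygy_lift ::
  "('o, 'm) preadd_cat \<Rightarrow> ('o \<Rightarrow> 'm \<times> 'm) \<Rightarrow> 'm \<Rightarrow> 'm \<Rightarrow> bool"
  where "syzygy_lift C S f f1 \<longleftrightarrow>
    (let (i, p) = S (Dom C f); (i', p') = S (Cod C f) in
       f1 \<in> Hom C (Dom C i) (Dom C i') \<and>
       (\<exists>f0 \<in> Hom C (Dom C p) (Dom C p').
          p' \<cdot>\<^bsub>C\<^esub> f0 = f \<cdot>\<^bsub>C\<^esub> p \<and> i' \<cdot>\<^bsub>C\<^esub> f1 = f0 \<cdot>\<^bsub>C\<^esub> i))"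

definition syzygy_map ::
  "('o, 'm) preadd_cat \<Rightarrow> ('m \<times> 'm) set \<Rightarrow> ('o \<Rightarrow> 'm \<times> 'm) \<Rightarrow> 'm set \<Rightarrow> 'm set"
  where "syzygy_map C E S F = stable_class C E (SOME f1. syzygy_lift C S (rep F) f1)"

section \<open>Functors\<close>

locale additive_functor =
  source: preadditive_category C + target: preadditive_category D
  for C :: "('o, 'm) preadd_cat" and D :: "('p, 'n) preadd_cat" +
  fixes Fo :: "'o \<Rightarrow> 'p" and Fm :: "'m \<Rightarrow> 'n"
  assumes map_obj: "a \<in> Obj C \<Longrightarrow> Fo a \<in> Obj D"
    and map_hom: "\<lbrakk>a \<in> Obj C; b \<in> Obj C\<rbrakk>
                  \<Longrightarrow> Fm \<in> hom (hom_group C a b) (hom_group D (Fo a) (Fo b))"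
    and map_id: "a \<in> Obj C \<Longrightarrow> Fm (Id C a) = Id D (Fo a)"
    and map_comp: "\<lbrakk>f \<in> Hom C a b; g \<in> Hom C b c\<rbrakk>
                  \<Longrightarrow> Fm (g \<cdot>\<^bsub>C\<^esub> f) = Fm g \<cdot>\<^bsub>D\<^esub> Fm f"

definition full_functor ::
  "('o, 'm) preadd_cat \<Rightarrow> ('p, 'n) preadd_cat \<Rightarrow> ('o \<Rightarrow> 'p) \<Rightarrow> ('m \<Rightarrow> 'n) \<Rightarrow> bool"
  where "full_functor C D Fo Fm \<longleftrightarrow>
    (\<forall>a \<in> Obj C. \<forall>b \<in> Obj C. Hom D (Fo a) (Fo b) \<subseteq> Fm ` Hom C a b)"

definition faithful_functor :: "('o, 'm) preadd_cat \<Rightarrow> ('m \<Rightarrow> 'n) \<Rightarrow> bool"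
  where "faithful_functor C Fm \<longleftrightarrow>
    (\<forall>a \<in> Obj C. \<forall>b \<in> Obj C. inj_on Fm (Hom C a b))"

end

theory Submission
  imports Defs
begin

text \<open>
  Let \<open>\<Omega> M \<rightarrow> P M \<rightarrow> M\<close> be the chosen sequence, with maps \<open>\<iota> M\<close> and \<open>\<pi> M\<close>.
  Vanishing of \<open>Ext\<^sup>1(M, Q)\<close> means that every arrow \<open>\<Omega> M \<rightarrow> Q\<close> extends along \<open>\<iota> M\<close>
  to \<open>P M\<close>.  For \<open>M\<close> in the left orthogonal of the projectives this holds for every
  projective \<open>Q\<close>, and fullness and faithfulness are diagram chases from it.

  Full (\<open>syz_lift_surj\<close>): given \<open>f1 : \<Omega> M \<rightarrow> \<Omega> N\<close>, extend \<open>\<iota> N \<cdot> f1 : \<Omega> M \<rightarrow> P N\<close>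
  along \<open>\<iota> M\<close> to \<open>f0 : P M \<rightarrow> P N\<close>; since \<open>\<pi> N \<cdot> f0\<close> kills \<open>\<iota> M\<close>, it induces
  an \<open>f : M \<rightarrow> N\<close> on the cokernel, and \<open>f1\<close> is a lift of \<open>f\<close>.

  Faithful (\<open>syz_lift_reflects_proj_factoring\<close>): if a lift \<open>f1\<close> of \<open>f\<close> factors as
  \<open>u \<cdot> k\<close> through a projective \<open>Q\<close>, extend \<open>k\<close> along \<open>\<iota> M\<close> to \<open>v : P M \<rightarrow> Q\<close>.  Then
  \<open>f0 - \<iota> N \<cdot> u \<cdot> v\<close> kills \<open>\<iota> M\<close>, so it equals \<open>y \<cdot> \<pi> M\<close> with \<open>y : M \<rightarrow> P N\<close>, and
  composing with \<open>\<pi> N\<close> gives \<open>f = \<pi> N \<cdot> y\<close>.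

  It remains to see that \<open>\<Omega> M\<close> is again in the left orthogonal.  Formally this is the
  dimension shift \<open>Ext\<^sup>n(\<Omega> M, Q) = Ext\<^sup>n\<^sup>+\<^sup>1(M, Q)\<close>, but the two sides are computed with
  unrelated resolutions.  Only vanishing matters, and by \<open>Ext_trivial_iff\<close> vanishing in
  degree \<open>n + 1\<close> is again an extension property, now along the \<open>n\<close>-th monic of the
  resolution.  The syzygies in two resolutions of an object are summands of each other up to
  projectives; this relation passes to the next syzygies and transports the extension
  property (\<open>stable_retract_of_syzygies\<close>), so vanishing is independent of the resolution.
\<close>

section \<open>Additive calculus of arrows\<close>

lemma hom_group_simps [simp]:
  "carrier (hom_group C a b) = Hom C a b"
  "f \<otimes>\<^bsub>hom_group C a b\<^esub> g = f \<boxplus>\<^bsub>C\<^esub> g"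
  "\<one>\<^bsub>hom_group C a b\<^esub> = Null C a b"
  by (simp_all add: hom_group_def)

lemma HomD:
  assumes "f \<in> Hom C a b"
  shows "f \<in> Arr C" "Dom C f = a" "Cod C f = b"
  using assms by (auto simp: Hom_def)

context preadditive_category
begin

lemma Hom_objs:
  assumes "f \<in> Hom C a b"
  shows "a \<in> Obj C" "b \<in> Obj C"
  using assms dom_obj cod_obj by (auto simp: Hom_def)

lemma hom_group_of_arrow: "f \<in> Hom C a b \<Longrightarrow> comm_group (hom_group C a b)"
  by (intro hom_comm_group) (auto dest: Hom_objs)

definition arr_minus  (infixl "\<boxminus>" 65)
  where "f \<boxminus> g = f \<boxplus> inv\<^bsub>hom_group C (Dom C f) (Cod C f)\<^esub> g"

lemma plus_hom: "\<lbrakk>f \<in> Hom C a b; g \<in> Hom C a b\<rbrakk> \<Longrightarrow> f \<boxplus> g \<in> Hom C a b"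
  using hom_group_of_arrow[of f a b] comm_group.axioms(2) group.is_monoid monoid.m_closed
  by (metis hom_group_simps(1,2))

lemma null_hom: "\<lbrakk>a \<in> Obj C; b \<in> Obj C\<rbrakk> \<Longrightarrow> Null C a b \<in> Hom C a b"
  using hom_comm_group[of a b] comm_group.axioms(2) group.is_monoid monoid.one_closed
  by (metis hom_group_simps(1,3))

lemma minus_hom:
  assumes "f \<in> Hom C a b" "g \<in> Hom C a b"
  shows "f \<boxminus> g \<in> Hom C a b"
proof -
  interpret comm_group "hom_group C a b" using assms hom_group_of_arrow by blast
  show ?thesis
    using assms inv_closed[of g] plus_hom by (simp add: arr_minus_def HomD[OF assms(1)])
qed

lemma minus_plus_cancel:
  assumes "f \<in> Hom C a b" "g \<in> Hom C a b"
  shows "(f \<boxminus> g) \<boxplus> g = f"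
proof -
  interpret comm_group "hom_group C a b" using assms hom_group_of_arrow by blast
  show ?thesis
    using assms m_assoc[of f "inv\<^bsub>hom_group C a b\<^esub> g" g] inv_closed[of g] l_inv[of g] r_one[of f]
    by (simp add: arr_minus_def HomD[OF assms(1)])
qed

lemma plus_comm:
  assumes "f \<in> Hom C a b" "g \<in> Hom C a b"
  shows "f \<boxplus> g = g \<boxplus> f"
proof -
  interpret comm_group "hom_group C a b" using assms hom_group_of_arrow by blast
  show ?thesis using assms m_comm[of f g] by simp
qed

lemma plus_right_cancel:
  assumes "f \<in> Hom C a b" "g \<in> Hom C a b" "h \<in> Hom C a b" "f \<boxplus> h = g \<boxplus> h"
  shows "f = g"
proof -
  interpret comm_group "hom_group C a b" using assms hom_group_of_arrow by blast
  show ?thesis using assms right_cancel[of h f g] by simp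
qed

lemma null_plus:
  assumes "f \<in> Hom C a b"
  shows "Null C a b \<boxplus> f = f"
proof -
  interpret comm_group "hom_group C a b" using assms hom_group_of_arrow by blast
  show ?thesis using assms l_one[of f] by simp
qed

lemma minus_eqI:
  assumes "f \<in> Hom C a b" "g \<in> Hom C a b" "h \<in> Hom C a b" "h \<boxplus> g = f"
  shows "f \<boxminus> g = h"
  using assms minus_plus_cancel minus_hom plus_right_cancel by metis

lemma minus_eq_null_iff:
  assumes "f \<in> Hom C a b" "g \<in> Hom C a b"
  shows "f \<boxminus> g = Null C a b \<longleftrightarrow> f = g"
  using assms minus_eqI null_plus null_hom minus_plus_cancel Hom_objs by metis

lemma comp_null_right:
  assumes "g \<in> Hom C b c" "a \<in> Obj C"
  shows "g \<cdot> Null C a b = Null C a c"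
proof -
  have n: "Null C a b \<in> Hom C a b" "Null C a c \<in> Hom C a c"
    using assms Hom_objs null_hom by blast+
  then have "g \<cdot> Null C a b \<boxplus> g \<cdot> Null C a b = Null C a c \<boxplus> g \<cdot> Null C a b"
    using assms by (metis comp_hom comp_plus_right null_plus)
  then show ?thesis using assms n plus_right_cancel comp_hom by meson
qed

lemma comp_null_left:
  assumes "f \<in> Hom C a b" "c \<in> Obj C"
  shows "Null C b c \<cdot> f = Null C a c"
proof -
  have n: "Null C b c \<in> Hom C b c" "Null C a c \<in> Hom C a c"
    using assms Hom_objs null_hom by blast+
  then have "Null C b c \<cdot> f \<boxplus> Null C b c \<cdot> f = Null C a c \<boxplus> Null C b c \<cdot> f"
    using assms by (metis comp_hom comp_plus_left null_plus)
  then show ?thesis using assms n plus_right_cancel comp_hom by meson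
qed

lemma comp_minus_right:
  assumes "f \<in> Hom C a b" "f' \<in> Hom C a b" "g \<in> Hom C b c"
  shows "g \<cdot> (f \<boxminus> f') = g \<cdot> f \<boxminus> g \<cdot> f'"
proof -
  have "g \<cdot> (f \<boxminus> f') \<boxplus> g \<cdot> f' = g \<cdot> f"
    using assms comp_plus_right[OF minus_hom] minus_plus_cancel by metis
  then show ?thesis using minus_eqI assms comp_hom minus_hom by metis
qed

lemma comp_minus_left:
  assumes "f \<in> Hom C a b" "g \<in> Hom C b c" "g' \<in> Hom C b c"
  shows "(g \<boxminus> g') \<cdot> f = g \<cdot> f \<boxminus> g' \<cdot> f"
proof -
  have "(g \<boxminus> g') \<cdot> f \<boxplus> g' \<cdot> f = g \<cdot> f"
    using assms comp_plus_left[OF _ minus_hom] minus_plus_cancel by metis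
  then show ?thesis using minus_eqI assms comp_hom minus_hom by metis
qed

lemma comp_left_group_hom:
  assumes "p \<in> Hom C b c" "a \<in> Obj C"
  shows "group_hom (hom_group C a b) (hom_group C a c) (\<lambda>k. p \<cdot> k)"
proof -
  have "group (hom_group C a b)" "group (hom_group C a c)"
    using hom_comm_group Hom_objs[OF assms(1)] assms(2) comm_group.axioms(2) by blast+
  then show ?thesis
    using assms(1) by (simp add: group_hom_def group_hom_axioms_def hom_def comp_hom comp_plus_right)
qed

lemma comp_right_group_hom:
  assumes "p \<in> Hom C a b" "c \<in> Obj C"
  shows "group_hom (hom_group C b c) (hom_group C a c) (\<lambda>k. k \<cdot> p)"
proof -
  have "group (hom_group C b c)" "group (hom_group C a c)"
    using hom_comm_group Hom_objs[OF assms(1)] assms(2) comm_group.axioms(2) by blast+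
  then show ?thesis
    using assms(1) by (simp add: group_hom_def group_hom_axioms_def hom_def comp_hom comp_plus_left)
qed

end

section \<open>Short exact sequences and projectives\<close>

context exact_category
begin

definition short_exact
  where "short_exact a i b p c \<longleftrightarrow> (i, p) \<in> E \<and> i \<in> Hom C a b \<and> p \<in> Hom C b c"

lemma short_exactI:
  assumes "(i, p) \<in> E"
  shows "short_exact (Dom C i) i (Dom C p) p (Cod C p)"
  using assms kernel_cokernel_pair[OF assms]
  by (auto simp: short_exact_def is_kernel_def Hom_def)

lemma short_exact_comp:
  assumes "short_exact a i b p c"
  shows "p \<cdot> i = Null C a c"
  using assms kernel_cokernel_pair[of i p] by (auto simp: short_exact_def is_kernel_def Hom_def)

lemma kernel_factor:
  assumes "short_exact a i b p c" "f \<in> Hom C x b" "p \<cdot> f = Null C x c"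
  shows "\<exists>!g. g \<in> Hom C x a \<and> i \<cdot> g = f"
proof -
  have 1: "i \<in> Hom C a b" "p \<in> Hom C b c" "is_kernel C i p"
    using assms(1) kernel_cokernel_pair[of i p] by (simp_all add: short_exact_def)
  have "Dom C p = b" "Cod C p = c" "Dom C i = a" using HomD[OF 1(1)] HomD[OF 1(2)] by simp_all
  then have "\<forall>f \<in> Arr C. Cod C f = b \<and> p \<cdot> f = Null C (Dom C f) c \<longrightarrow>
      (\<exists>!g. g \<in> Hom C (Dom C f) a \<and> i \<cdot> g = f)"
    using 1(3) unfolding is_kernel_def by simp
  from bspec[OF this HomD(1)[OF assms(2)]] show ?thesis
    using assms(3) by (simp add: HomD[OF assms(2)])
qed

lemma cokernel_factor:
  assumes "short_exact a i b p c" "f \<in> Hom C b x" "f \<cdot> i = Null C a x"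
  shows "\<exists>!g. g \<in> Hom C c x \<and> g \<cdot> p = f"
proof -
  have 1: "i \<in> Hom C a b" "p \<in> Hom C b c" "is_cokernel C p i"
    using assms(1) kernel_cokernel_pair[of i p] by (simp_all add: short_exact_def)
  have "Cod C i = b" "Cod C p = c" "Dom C i = a" using HomD[OF 1(1)] HomD[OF 1(2)] by simp_all
  then have "\<forall>f \<in> Arr C. Dom C f = b \<and> f \<cdot> i = Null C a (Cod C f) \<longrightarrow>
      (\<exists>!g. g \<in> Hom C c (Cod C f) \<and> g \<cdot> p = f)"
    using 1(3) unfolding is_cokernel_def by simp
  from bspec[OF this HomD(1)[OF assms(2)]] show ?thesis
    using assms(3) by (simp add: HomD[OF assms(2)])
qed

lemma monic_cancel:
  assumes "short_exact a i b p c" "g \<in> Hom C x a" "g' \<in> Hom C x a" "i \<cdot> g = i \<cdot> g'"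
  shows "g = g'"
proof -
  have 1: "i \<in> Hom C a b" "p \<in> Hom C b c"
    using assms by (auto simp: short_exact_def)
  have 2: "i \<cdot> g \<in> Hom C x b" using 1 assms comp_hom by blast
  have "p \<cdot> (i \<cdot> g) = Null C x c"
    using comp_assoc[OF assms(2) 1(1,2)] short_exact_comp[OF assms(1)]
      comp_null_left[OF assms(2)] Hom_objs[OF 1(2)] by simp
  then show ?thesis using kernel_factor[OF assms(1) 2] assms(2-4) by auto
qed

lemma epic_cancel:
  assumes "short_exact a i b p c" "g \<in> Hom C c x" "g' \<in> Hom C c x" "g \<cdot> p = g' \<cdot> p"
  shows "g = g'"
proof -
  have 1: "i \<in> Hom C a b" "p \<in> Hom C b c"
    using assms by (auto simp: short_exact_def)
  have 2: "g \<cdot> p \<in> Hom C b x" using 1 assms comp_hom by blast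
  have "(g \<cdot> p) \<cdot> i = Null C a x"
    using comp_assoc[OF 1(1,2) assms(2)] short_exact_comp[OF assms(1)]
      comp_null_right[OF assms(2)] Hom_objs[OF 1(1)] by simp
  then show ?thesis using cokernel_factor[OF assms(1) 2] assms(2-4) by auto
qed

lemma projective_lift:
  assumes "Q \<in> projectives C E" "short_exact a i b p c" "f \<in> Hom C Q c"
  shows "\<exists>g \<in> Hom C Q b. p \<cdot> g = f"
proof -
  have "(i, p) \<in> E" "p \<in> Hom C b c" using assms(2) by (auto simp: short_exact_def)
  then have "(\<lambda>f. p \<cdot> f) ` Hom C Q (Dom C p) = Hom C Q (Cod C p)"
    using assms(1) by (fastforce simp only: projectives_def mem_Collect_eq split: prod.splits)
  then have "f \<in> (\<lambda>f. p \<cdot> f) ` Hom C Q b" using assms(3) HomD[OF \<open>p \<in> Hom C b c\<close>] by simp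
  then show ?thesis by blast
qed

lemma proj_factoringI:
  "\<lbrakk>Q \<in> projectives C E; k \<in> Hom C a Q; h \<in> Hom C Q b\<rbrakk> \<Longrightarrow> h \<cdot> k \<in> proj_factoring C E a b"
  by (auto simp: proj_factoring_def)

lemma proj_factoringE:
  assumes "f \<in> proj_factoring C E a b"
  obtains k h Q where "f = h \<cdot> k" "Q \<in> projectives C E" "k \<in> Hom C a Q" "h \<in> Hom C Q b"
  using assms by (auto simp: proj_factoring_def)

lemma proj_factoring_comp_left:
  assumes "f \<in> proj_factoring C E a b" "g \<in> Hom C b c"
  shows "g \<cdot> f \<in> proj_factoring C E a c"
  using assms(1)
proof (rule proj_factoringE)
  fix k h Q
  assume *: "f = h \<cdot> k" "Q \<in> projectives C E" "k \<in> Hom C a Q" "h \<in> Hom C Q b"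
  have "g \<cdot> f = (g \<cdot> h) \<cdot> k" using comp_assoc[OF *(3,4) assms(2)] *(1) by simp
  then show ?thesis using proj_factoringI[OF *(2,3) comp_hom[OF *(4) assms(2)]] by simp
qed

lemma proj_factoring_comp_right:
  assumes "f \<in> proj_factoring C E b c" "g \<in> Hom C a b"
  shows "f \<cdot> g \<in> proj_factoring C E a c"
  using assms(1)
proof (rule proj_factoringE)
  fix k h Q
  assume *: "f = h \<cdot> k" "Q \<in> projectives C E" "k \<in> Hom C b Q" "h \<in> Hom C Q c"
  have "f \<cdot> g = h \<cdot> (k \<cdot> g)" using comp_assoc[OF assms(2) *(3,4)] *(1) by simp
  then show ?thesis using proj_factoringI[OF *(2) comp_hom[OF assms(2) *(3)] *(4)] by simp
qed

text \<open>
  Factoring through some projective amounts to lifting along one fixed admissible epic from a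
  projective.  The arrows with this property are therefore visibly closed under addition.
\<close>

lemma proj_factoring_iff_lift:
  assumes "short_exact a i P p b" "P \<in> projectives C E"
  shows "f \<in> proj_factoring C E x b \<longleftrightarrow> (\<exists>k \<in> Hom C x P. f = p \<cdot> k)"
proof
  have p: "p \<in> Hom C P b" using assms(1) by (simp add: short_exact_def)
  assume "f \<in> proj_factoring C E x b"
  then show "\<exists>k \<in> Hom C x P. f = p \<cdot> k"
  proof (rule proj_factoringE)
    fix k h Q
    assume *: "f = h \<cdot> k" "Q \<in> projectives C E" "k \<in> Hom C x Q" "h \<in> Hom C Q b"
    obtain h' where h': "h' \<in> Hom C Q P" "p \<cdot> h' = h"
      using projective_lift[OF *(2) assms(1) *(4)] by blast
    have "f = p \<cdot> (h' \<cdot> k)" using comp_assoc[OF *(3) h'(1) p] h'(2) *(1) by simp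
    then show ?thesis using comp_hom[OF *(3) h'(1)] by blast
  qed
next
  assume "\<exists>k \<in> Hom C x P. f = p \<cdot> k"
  then show "f \<in> proj_factoring C E x b"
    using assms(1) proj_factoringI[OF assms(2)] by (auto simp: short_exact_def)
qed

section \<open>Lifting arrows to projective presentations\<close>

text \<open>
  A lift of \<open>f\<close> is the left-hand component \<open>f1\<close> of a morphism of sequences from \<open>(i, p)\<close>
  to \<open>(i', p')\<close> that ends in \<open>f\<close>.  The middle component is hidden, so that lifts can be
  composed and subtracted as a relation between the outer components alone.
\<close>

definition lifts_to
  where "lifts_to i p i' p' f f1 \<longleftrightarrow>
    f \<in> Hom C (Cod C p) (Cod C p') \<and> f1 \<in> Hom C (Dom C i) (Dom C i') \<and>
    (\<exists>f0 \<in> Hom C (Dom C p) (Dom C p'). p' \<cdot> f0 = f \<cdot> p \<and> i' \<cdot> f1 = f0 \<cdot> i)"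

lemma lifts_toI:
  assumes "short_exact a i P p M" "short_exact a' i' P' p' M'"
    and "f \<in> Hom C M M'" "f1 \<in> Hom C a a'" "f0 \<in> Hom C P P'"
    and "p' \<cdot> f0 = f \<cdot> p" "i' \<cdot> f1 = f0 \<cdot> i"
  shows "lifts_to i p i' p' f f1"
  using assms unfolding lifts_to_def short_exact_def by (auto simp: Hom_def)

lemma lifts_toE:
  assumes "lifts_to i p i' p' f f1"
    and "short_exact a i P p M" "short_exact a' i' P' p' M'"
  obtains f0 where "f \<in> Hom C M M'" "f1 \<in> Hom C a a'" "f0 \<in> Hom C P P'"
    "p' \<cdot> f0 = f \<cdot> p" "i' \<cdot> f1 = f0 \<cdot> i"
proof -
  have "Dom C i = a" "Dom C p = P" "Cod C p = M" "Dom C i' = a'" "Dom C p' = P'" "Cod C p' = M'"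
    using assms(2,3) by (simp_all add: short_exact_def Hom_def)
  then show thesis using assms(1) that unfolding lifts_to_def by metis
qed

text \<open>
  Projectivity of \<open>P\<close> lifts \<open>f \<cdot> p\<close> along \<open>p'\<close>, and the lift restricts to the kernels.
\<close>

lemma lifts_to_exists:
  assumes s: "short_exact a i P p M" "P \<in> projectives C E" "short_exact a' i' P' p' M'"
    and f: "f \<in> Hom C M M'"
  shows "\<exists>f1. lifts_to i p i' p' f f1"
proof -
  have h: "i \<in> Hom C a P" "p \<in> Hom C P M" "p' \<in> Hom C P' M'"
    using s by (simp_all add: short_exact_def)
  obtain f0 where f0: "f0 \<in> Hom C P P'" "p' \<cdot> f0 = f \<cdot> p"
    using projective_lift[OF s(2,3) comp_hom[OF h(2) f]] by blast
  have "p' \<cdot> (f0 \<cdot> i) = Null C a M'"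
    using comp_assoc[OF h(1) f0(1) h(3)] comp_assoc[OF h(1,2) f] f0(2)
      short_exact_comp[OF s(1)] comp_null_right[OF f] Hom_objs[OF h(1)] by simp
  then obtain f1 where "f1 \<in> Hom C a a'" "i' \<cdot> f1 = f0 \<cdot> i"
    using kernel_factor[OF s(3) comp_hom[OF h(1) f0(1)]] by blast
  then show ?thesis using lifts_toI[OF s(1,3) f _ f0(1)] f0(2) by blast
qed

lemma lifts_to_id:
  assumes s: "short_exact a i P p M"
  shows "lifts_to i p i p (Id C M) (Id C a)"
proof -
  have h: "i \<in> Hom C a P" "p \<in> Hom C P M" using s by (simp_all add: short_exact_def)
  note o = Hom_objs[OF h(1)] Hom_objs[OF h(2)]
  show ?thesis
    by (rule lifts_toI[OF s s id_hom id_hom id_hom])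
      (simp_all add: o comp_id_left[OF h(1)] comp_id_left[OF h(2)]
        comp_id_right[OF h(1)] comp_id_right[OF h(2)])
qed

lemma lifts_to_comp:
  assumes s: "short_exact a i P p M" "short_exact a' i' P' p' M'" "short_exact a'' i'' P'' p'' M''"
    and f: "lifts_to i p i' p' f f1" and g: "lifts_to i' p' i'' p'' g g1"
  shows "lifts_to i p i'' p'' (g \<cdot> f) (g1 \<cdot> f1)"
proof -
  have h: "i \<in> Hom C a P" "p \<in> Hom C P M" "i' \<in> Hom C a' P'" "p' \<in> Hom C P' M'"
    "i'' \<in> Hom C a'' P''" "p'' \<in> Hom C P'' M''"
    using s by (simp_all add: short_exact_def)
  obtain f0 where f: "f \<in> Hom C M M'" "f1 \<in> Hom C a a'" "f0 \<in> Hom C P P'"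
    "p' \<cdot> f0 = f \<cdot> p" "i' \<cdot> f1 = f0 \<cdot> i"
    using f s by (blast elim: lifts_toE)
  obtain g0 where g: "g \<in> Hom C M' M''" "g1 \<in> Hom C a' a''" "g0 \<in> Hom C P' P''"
    "p'' \<cdot> g0 = g \<cdot> p'" "i'' \<cdot> g1 = g0 \<cdot> i'"
    using g s by (blast elim: lifts_toE)
  have "p'' \<cdot> (g0 \<cdot> f0) = (p'' \<cdot> g0) \<cdot> f0" using comp_assoc[OF f(3) g(3) h(6)] by simp
  also have "\<dots> = g \<cdot> (p' \<cdot> f0)" using comp_assoc[OF f(3) h(4) g(1)] g(4) by simp
  also have "\<dots> = (g \<cdot> f) \<cdot> p" using comp_assoc[OF h(2) f(1) g(1)] f(4) by simp
  finally have 1: "p'' \<cdot> (g0 \<cdot> f0) = (g \<cdot> f) \<cdot> p" .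
  have "i'' \<cdot> (g1 \<cdot> f1) = (i'' \<cdot> g1) \<cdot> f1" using comp_assoc[OF f(2) g(2) h(5)] by simp
  also have "\<dots> = g0 \<cdot> (i' \<cdot> f1)" using comp_assoc[OF f(2) h(3) g(3)] g(5) by simp
  also have "\<dots> = (g0 \<cdot> f0) \<cdot> i" using comp_assoc[OF h(1) f(3) g(3)] f(5) by simp
  finally show ?thesis
    using lifts_toI[OF s(1,3) comp_hom[OF f(1) g(1)] comp_hom[OF f(2) g(2)] comp_hom[OF f(3) g(3)]] 1
    by simp
qed

lemma lifts_to_plus:
  assumes s: "short_exact a i P p M" "short_exact a' i' P' p' M'"
    and f: "lifts_to i p i' p' f f1" and g: "lifts_to i p i' p' g g1"
  shows "lifts_to i p i' p' (f \<boxplus> g) (f1 \<boxplus> g1)"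
proof -
  have h: "i \<in> Hom C a P" "p \<in> Hom C P M" "i' \<in> Hom C a' P'" "p' \<in> Hom C P' M'"
    using s by (simp_all add: short_exact_def)
  obtain f0 where f: "f \<in> Hom C M M'" "f1 \<in> Hom C a a'" "f0 \<in> Hom C P P'"
    "p' \<cdot> f0 = f \<cdot> p" "i' \<cdot> f1 = f0 \<cdot> i"
    using f s by (blast elim: lifts_toE)
  obtain g0 where g: "g \<in> Hom C M M'" "g1 \<in> Hom C a a'" "g0 \<in> Hom C P P'"
    "p' \<cdot> g0 = g \<cdot> p" "i' \<cdot> g1 = g0 \<cdot> i"
    using g s by (blast elim: lifts_toE)
  show ?thesis
    by (rule lifts_toI[OF s plus_hom[OF f(1) g(1)] plus_hom[OF f(2) g(2)] plus_hom[OF f(3) g(3)]])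
      (simp_all add: comp_plus_right[OF f(3) g(3) h(4)] comp_plus_left[OF h(2) f(1) g(1)]
        comp_plus_right[OF f(2) g(2) h(3)] comp_plus_left[OF h(1) f(3) g(3)] f(4,5) g(4,5))
qed

lemma lifts_to_minus:
  assumes s: "short_exact a i P p M" "short_exact a' i' P' p' M'"
    and f: "lifts_to i p i' p' f f1" and g: "lifts_to i p i' p' g g1"
  shows "lifts_to i p i' p' (f \<boxminus> g) (f1 \<boxminus> g1)"
proof -
  have h: "i \<in> Hom C a P" "p \<in> Hom C P M" "i' \<in> Hom C a' P'" "p' \<in> Hom C P' M'"
    using s by (simp_all add: short_exact_def)
  obtain f0 where f: "f \<in> Hom C M M'" "f1 \<in> Hom C a a'" "f0 \<in> Hom C P P'"
    "p' \<cdot> f0 = f \<cdot> p" "i' \<cdot> f1 = f0 \<cdot> i"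
    using f s by (blast elim: lifts_toE)
  obtain g0 where g: "g \<in> Hom C M M'" "g1 \<in> Hom C a a'" "g0 \<in> Hom C P P'"
    "p' \<cdot> g0 = g \<cdot> p" "i' \<cdot> g1 = g0 \<cdot> i"
    using g s by (blast elim: lifts_toE)
  show ?thesis
    by (rule lifts_toI[OF s minus_hom[OF f(1) g(1)] minus_hom[OF f(2) g(2)] minus_hom[OF f(3) g(3)]])
      (simp_all add: comp_minus_right[OF f(3) g(3) h(4)] comp_minus_left[OF h(2) f(1) g(1)]
        comp_minus_right[OF f(2) g(2) h(3)] comp_minus_left[OF h(1) f(3) g(3)] f(4,5) g(4,5))
qed

text \<open>
  Since \<open>f\<close> factors through a projective, \<open>f = p' \<cdot> k\<close> for some \<open>k\<close>.  The middle component
  \<open>f0\<close> of the morphism of sequences and \<open>k \<cdot> p\<close> are then two lifts of \<open>f \<cdot> p\<close> along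
  \<open>p'\<close>, so their difference is \<open>i' \<cdot> s\<close> for some \<open>s\<close>; restricting to the kernel of \<open>p\<close>
  gives \<open>f1 = s \<cdot> i\<close>.  Applied to the difference of two lifts, this is their uniqueness in
  the stable category.
\<close>

lemma lift_of_proj_factoring:
  assumes s: "short_exact a i P p M" "short_exact a' i' P' p' M'" "P' \<in> projectives C E"
    and f: "lifts_to i p i' p' f f1" and pf: "f \<in> proj_factoring C E M M'"
  shows "\<exists>s \<in> Hom C P a'. f1 = s \<cdot> i"
proof -
  have h: "i \<in> Hom C a P" "p \<in> Hom C P M" "i' \<in> Hom C a' P'" "p' \<in> Hom C P' M'"
    using s by (simp_all add: short_exact_def)
  obtain f0 where f: "f \<in> Hom C M M'" "f1 \<in> Hom C a a'" "f0 \<in> Hom C P P'"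
    "p' \<cdot> f0 = f \<cdot> p" "i' \<cdot> f1 = f0 \<cdot> i"
    using f s by (blast elim: lifts_toE)
  obtain k where k: "k \<in> Hom C M P'" "f = p' \<cdot> k"
    using pf proj_factoring_iff_lift[OF s(2,3)] by blast
  have kp: "k \<cdot> p \<in> Hom C P P'" using comp_hom[OF h(2) k(1)] .
  have "p' \<cdot> (f0 \<boxminus> k \<cdot> p) = f \<cdot> p \<boxminus> f \<cdot> p"
    using comp_minus_right[OF f(3) kp h(4)] comp_assoc[OF h(2) k(1) h(4)] f(4) k(2) by simp
  also have "\<dots> = Null C P M'"
    using minus_eq_null_iff[OF comp_hom[OF h(2) f(1)] comp_hom[OF h(2) f(1)]] by simp
  finally obtain s where s': "s \<in> Hom C P a'" "i' \<cdot> s = f0 \<boxminus> k \<cdot> p"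
    using kernel_factor[OF s(2) minus_hom[OF f(3) kp]] by blast
  have "(k \<cdot> p) \<cdot> i = Null C a P'"
    using comp_assoc[OF h(1,2) k(1)] short_exact_comp[OF s(1)]
      comp_null_right[OF k(1)] Hom_objs[OF h(1)] by simp
  then have "f0 \<cdot> i = (f0 \<boxminus> k \<cdot> p) \<cdot> i \<boxplus> Null C a P'"
    using minus_plus_cancel[OF f(3) kp] comp_plus_left[OF h(1) minus_hom[OF f(3) kp] kp] by simp
  also have "\<dots> = (f0 \<boxminus> k \<cdot> p) \<cdot> i"
    using null_plus plus_comm null_hom Hom_objs comp_hom[OF h(1) minus_hom[OF f(3) kp]] by metis
  finally have "i' \<cdot> f1 = (i' \<cdot> s) \<cdot> i" using f(5) s'(2) by simp
  then have "i' \<cdot> f1 = i' \<cdot> (s \<cdot> i)" using comp_assoc[OF h(1) s'(1) h(3)] by simp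
  then show ?thesis using monic_cancel[OF s(2) f(2) comp_hom[OF h(1) s'(1)]] s'(1) by blast
qed

end

section \<open>Vanishing of Ext\<close>

text \<open>
  With cocycles \<open>K\<close> and coboundaries \<open>B\<close>, this turns vanishing of cohomology into
  exactness of the complex.
\<close>

lemma (in comm_group) trivial_subquotient_iff:
  assumes "subgroup K G" "subgroup B G" "B \<subseteq> K"
  shows "trivial_group (G\<lparr>carrier := K\<rparr> Mod B) \<longleftrightarrow> K \<subseteq> B"
proof -
  let ?H = "G\<lparr>carrier := K\<rparr>"
  interpret H: group ?H using subgroup.subgroup_is_group[OF assms(1)] is_group by blast
  interpret H: comm_group ?H
    using subgroup.subset[OF assms(1)] m_comm by (intro H.group_comm_groupI) auto
  have B: "subgroup B ?H" using subgroup_incl assms by blast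
  have "group (?H Mod B)" using H.abelian_FactGroup[OF B] comm_group.axioms(2) by blast
  then have "trivial_group (?H Mod B) \<longleftrightarrow> (\<lambda>x. B #>\<^bsub>?H\<^esub> x) ` K = {B}"
    by (simp add: trivial_group_def carrier_FactGroup)
  also have "\<dots> \<longleftrightarrow> (\<forall>x \<in> K. B #>\<^bsub>?H\<^esub> x = B)"
    using subgroup.one_closed[OF assms(1)] by auto
  also have "\<dots> \<longleftrightarrow> (\<forall>x \<in> K. x \<in> B)"
    using H.coset_join1[OF _ _ B] H.coset_join2[OF _ B] by auto
  finally show ?thesis by blast
qed

context exact_category
begin

definition extends_along
  where "extends_along i Y \<longleftrightarrow> (\<forall>g \<in> Hom C (Dom C i) Y. \<exists>h \<in> Hom C (Cod C i) Y. h \<cdot> i = g)"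

lemma proj_resolution_short_exact:
  assumes "proj_resolution C E M R"
  shows "short_exact (Dom C (fst (R n))) (fst (R n)) (Dom C (snd (R n))) (snd (R n)) (Cod C (snd (R n)))"
  using assms short_exactI[of "fst (R n)" "snd (R n)"] by (simp add: proj_resolution_def)

text \<open>
  Write \<open>i\<^sub>n : Z\<^sub>n\<^sub>+\<^sub>1 \<rightarrow> P\<^sub>n\<close> and \<open>p\<^sub>n : P\<^sub>n \<rightarrow> Z\<^sub>n\<close> for the maps of the resolution.  As
  \<open>p\<^sub>n\<^sub>+\<^sub>1\<close> is a cokernel of \<open>i\<^sub>n\<^sub>+\<^sub>1\<close>, the cocycles in degree \<open>n + 1\<close> are the composites
  \<open>g \<cdot> p\<^sub>n\<^sub>+\<^sub>1\<close> with \<open>g : Z\<^sub>n\<^sub>+\<^sub>1 \<rightarrow> Y\<close>.  The coboundaries are the \<open>h \<cdot> i\<^sub>n \<cdot> p\<^sub>n\<^sub>+\<^sub>1\<close>, and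
  \<open>p\<^sub>n\<^sub>+\<^sub>1\<close> cancels, so every cocycle is a coboundary exactly when
  every \<open>g\<close> has the form \<open>h \<cdot> i\<^sub>n\<close>.
\<close>

lemma Ext_trivial_iff:
  assumes R: "proj_resolution C E M (the_resolution C E M)" and Y: "Y \<in> Obj C"
  shows "trivial_group (Ext C E (Suc n) M Y) \<longleftrightarrow> extends_along (fst (the_resolution C E M n)) Y"
proof -
  let ?R = "the_resolution C E M"
  define i where "i k = fst (?R k)" for k
  define p where "p k = snd (?R k)" for k
  define Z where "Z k = Cod C (p k)" for k
  define P where "P k = Dom C (p k)" for k
  have ZS: "Z (Suc k) = Dom C (i k)" for k
    using R by (simp add: proj_resolution_def Z_def i_def p_def)
  have se: "short_exact (Z (Suc k)) (i k) (P k) (p k) (Z k)" for k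
    unfolding ZS unfolding Z_def P_def i_def p_def by (rule proj_resolution_short_exact[OF R])
  have ih: "i k \<in> Hom C (Z (Suc k)) (P k)" and ph: "p k \<in> Hom C (P k) (Z k)" for k
    using se by (simp_all add: short_exact_def)
  define d where "d k = i k \<cdot> p (Suc k)" for k
  have dh: "d k \<in> Hom C (P (Suc k)) (P k)" for k
    unfolding d_def using comp_hom[OF ph ih] .
  have PO: "P k \<in> Obj C" for k using Hom_objs(1)[OF ph] .
  let ?G = "hom_group C (P (Suc n)) Y"
  let ?K = "kernel ?G (hom_group C (P (Suc (Suc n))) Y) (\<lambda>f. f \<cdot> d (Suc n))"
  let ?B = "(\<lambda>f. f \<cdot> d n) ` Hom C (P n) Y"
  interpret G: comm_group ?G using hom_comm_group PO Y .
  interpret d0: group_hom "hom_group C (P n) Y" ?G "\<lambda>f. f \<cdot> d n"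
    using comp_right_group_hom[OF dh Y] .
  interpret d1: group_hom ?G "hom_group C (P (Suc (Suc n))) Y" "\<lambda>f. f \<cdot> d (Suc n)"
    using comp_right_group_hom[OF dh Y] .
  have K: "subgroup ?K ?G" using d1.subgroup_kernel .
  have B: "subgroup ?B ?G" using d0.img_is_subgroup by simp
  have mem_K: "f \<in> ?K \<longleftrightarrow> (\<exists>g \<in> Hom C (Z (Suc n)) Y. f = g \<cdot> p (Suc n))" for f
  proof
    assume "f \<in> ?K"
    then have f: "f \<in> Hom C (P (Suc n)) Y" "f \<cdot> d (Suc n) = Null C (P (Suc (Suc n))) Y"
      by (simp_all add: kernel_def)
    have fi: "f \<cdot> i (Suc n) \<in> Hom C (Z (Suc (Suc n))) Y" using comp_hom[OF ih f(1)] .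
    have n: "Null C (Z (Suc (Suc n))) Y \<in> Hom C (Z (Suc (Suc n))) Y"
      using null_hom Hom_objs[OF fi] by blast
    have "(f \<cdot> i (Suc n)) \<cdot> p (Suc (Suc n)) = Null C (Z (Suc (Suc n))) Y \<cdot> p (Suc (Suc n))"
      using comp_assoc[OF ph ih f(1)] f(2) comp_null_left[OF ph Y] by (simp add: d_def)
    then have "f \<cdot> i (Suc n) = Null C (Z (Suc (Suc n))) Y"
      using epic_cancel[OF se fi n] by blast
    then show "\<exists>g \<in> Hom C (Z (Suc n)) Y. f = g \<cdot> p (Suc n)"
      using cokernel_factor[OF se f(1)] by blast
  next
    assume "\<exists>g \<in> Hom C (Z (Suc n)) Y. f = g \<cdot> p (Suc n)"
    then obtain g where g: "g \<in> Hom C (Z (Suc n)) Y" "f = g \<cdot> p (Suc n)" by blast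
    have f: "f \<in> Hom C (P (Suc n)) Y" using g comp_hom[OF ph g(1)] by simp
    have "f \<cdot> i (Suc n) = Null C (Z (Suc (Suc n))) Y"
      using comp_assoc[OF ih ph g(1)] short_exact_comp[OF se]
        comp_null_right[OF g(1)] Hom_objs[OF ih] g(2) by simp
    then have "f \<cdot> d (Suc n) = Null C (P (Suc (Suc n))) Y"
      using comp_assoc[OF ph ih f] comp_null_left[OF ph Y] by (simp add: d_def)
    then show "f \<in> ?K" using f by (simp add: kernel_def)
  qed
  have comp_d: "h \<cdot> d n = (h \<cdot> i n) \<cdot> p (Suc n)" if "h \<in> Hom C (P n) Y" for h
    using comp_assoc[OF ph ih that] by (simp add: d_def)
  have BK: "?B \<subseteq> ?K"
  proof
    fix f assume "f \<in> ?B"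
    then obtain h where "h \<in> Hom C (P n) Y" "f = h \<cdot> d n" by blast
    then show "f \<in> ?K" unfolding mem_K using comp_d comp_hom[OF ih] by blast
  qed
  have "Ext C E (Suc n) M Y = ?G\<lparr>carrier := ?K\<rparr> Mod ?B"
    unfolding Ext_def Let_def cocycles_def coboundaries.simps cochain_group_def codiff_def
      hom_group_simps d_def P_def p_def i_def by (rule refl)
  then have "trivial_group (Ext C E (Suc n) M Y) \<longleftrightarrow> ?K \<subseteq> ?B"
    using G.trivial_subquotient_iff[OF K B BK] by simp
  also have "\<dots> \<longleftrightarrow> (\<forall>g \<in> Hom C (Z (Suc n)) Y. \<exists>h \<in> Hom C (P n) Y. h \<cdot> i n = g)" (is "?l \<longleftrightarrow> ?r")
  proof
    assume l: ?l
    show ?r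
    proof
      fix g assume g: "g \<in> Hom C (Z (Suc n)) Y"
      then have "g \<cdot> p (Suc n) \<in> ?B" using l mem_K by blast
      then obtain h where h: "h \<in> Hom C (P n) Y" "g \<cdot> p (Suc n) = (h \<cdot> i n) \<cdot> p (Suc n)"
        using comp_d by auto
      then have "g = h \<cdot> i n" using epic_cancel[OF se g comp_hom[OF ih h(1)]] by blast
      then show "\<exists>h \<in> Hom C (P n) Y. h \<cdot> i n = g" using h(1) by blast
    qed
  next
    assume r: ?r
    show ?l
    proof
      fix f assume "f \<in> ?K"
      then obtain g where g: "g \<in> Hom C (Z (Suc n)) Y" "f = g \<cdot> p (Suc n)" using mem_K by blast
      then obtain h where h: "h \<in> Hom C (P n) Y" "h \<cdot> i n = g" using r by blast
      then have "f = h \<cdot> d n" using comp_d g(2) by simp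
      then show "f \<in> ?B" using h(1) by blast
    qed
  qed
  also have "\<dots> \<longleftrightarrow> extends_along (i n) Y"
    using HomD[OF ih[of n]] by (simp add: extends_along_def)
  finally show ?thesis by (simp add: i_def)
qed

text \<open>
  \<open>M'\<close> is a retract of \<open>M\<close> in the stable category.  Syzygies taken from different sequences
  are related in this way though they need not be isomorphic, and the relation is strong
  enough to pass vanishing of \<open>Ext\<close> from \<open>M\<close> to \<open>M'\<close>.
\<close>

definition stable_retract
  where "stable_retract M' M \<longleftrightarrow> (\<exists>f \<in> Hom C M M'. \<exists>g \<in> Hom C M' M.
    Id C M' \<boxminus> f \<cdot> g \<in> proj_factoring C E M' M')"

text \<open>
  Lift the retraction \<open>f\<close> and its section \<open>g\<close> to \<open>f1\<close> and \<open>g1\<close>.  The defect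
  \<open>Id - f \<cdot> g\<close> factors through a projective, hence its lift \<open>Id - f1 \<cdot> g1\<close> factors through
  \<open>i'\<close> as \<open>t \<cdot> i'\<close>, which makes \<open>a'\<close> a stable retract of \<open>a\<close>.  An arrow
  \<open>x = x \<cdot> t \<cdot> i' + x \<cdot> f1 \<cdot> g1\<close> on \<open>a'\<close> therefore extends along \<open>i'\<close>: the first summand
  visibly, the second because \<open>x \<cdot> f1\<close> extends along \<open>i\<close> and \<open>i \<cdot> g1\<close> factors through \<open>i'\<close>.
\<close>

lemma stable_retract_of_syzygies:
  assumes s: "short_exact a i P p M" "P \<in> projectives C E"
    "short_exact a' i' P' p' M'" "P' \<in> projectives C E"
    and r: "stable_retract M' M"
  shows "stable_retract a' a" and "extends_along i Y \<Longrightarrow> extends_along i' Y"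
proof -
  have h: "i \<in> Hom C a P" "p \<in> Hom C P M" "i' \<in> Hom C a' P'" "p' \<in> Hom C P' M'"
    using s by (simp_all add: short_exact_def)
  obtain f g where fg: "f \<in> Hom C M M'" "g \<in> Hom C M' M"
    "Id C M' \<boxminus> f \<cdot> g \<in> proj_factoring C E M' M'"
    using r by (auto simp: stable_retract_def)
  obtain f1 where f1: "lifts_to i p i' p' f f1" using lifts_to_exists[OF s(1-3) fg(1)] by blast
  obtain g1 where g1: "lifts_to i' p' i p g g1" using lifts_to_exists[OF s(3,4,1) fg(2)] by blast
  have "lifts_to i' p' i' p' (Id C M' \<boxminus> f \<cdot> g) (Id C a' \<boxminus> f1 \<cdot> g1)"
    by (intro lifts_to_minus[OF s(3,3)] lifts_to_id[OF s(3)] lifts_to_comp[OF s(3,1,3) g1 f1])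
  then obtain t where t: "t \<in> Hom C P' a'" "Id C a' \<boxminus> f1 \<cdot> g1 = t \<cdot> i'"
    using lift_of_proj_factoring[OF s(3,3,4)] fg(3) by blast
  have f1': "f1 \<in> Hom C a a'" using f1 by (rule lifts_toE[OF _ s(1,3)])
  obtain g0 where g0: "g1 \<in> Hom C a' a" "g0 \<in> Hom C P' P" "i \<cdot> g1 = g0 \<cdot> i'"
    using g1 by (rule lifts_toE[OF _ s(3,1)])
  show "stable_retract a' a"
    unfolding stable_retract_def 
    using t(2) proj_factoringI[OF s(4) h(3) t(1)]
    by (intro bexI[OF _ f1'] bexI[OF _ g0(1)]) simp
  have ida: "Id C a' \<in> Hom C a' a'" using id_hom Hom_objs[OF h(3)] by blast
  have fg1: "f1 \<cdot> g1 \<in> Hom C a' a'" using comp_hom[OF g0(1) f1'] .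
  show "extends_along i' Y" if ext: "extends_along i Y"
    unfolding extends_along_def
  proof
    fix x assume "x \<in> Hom C (Dom C i') Y"
    then have x: "x \<in> Hom C a' Y" using HomD[OF h(3)] by simp
    obtain y where y: "y \<in> Hom C P Y" "y \<cdot> i = x \<cdot> f1"
      using ext comp_hom[OF f1' x] HomD[OF h(1)] by (auto simp: extends_along_def)
    have "Id C a' = t \<cdot> i' \<boxplus> f1 \<cdot> g1" using minus_plus_cancel[OF ida fg1] t(2) by simp
    then have "x = x \<cdot> (t \<cdot> i') \<boxplus> x \<cdot> (f1 \<cdot> g1)"
      using comp_plus_right[OF comp_hom[OF h(3) t(1)] fg1 x] comp_id_right[OF x] by simp
    also have "x \<cdot> (f1 \<cdot> g1) = (x \<cdot> f1) \<cdot> g1" using comp_assoc[OF g0(1) f1' x] by simp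
    also have "\<dots> = y \<cdot> (i \<cdot> g1)" using comp_assoc[OF g0(1) h(1) y(1)] y(2) by simp
    also have "\<dots> = (y \<cdot> g0) \<cdot> i'" using comp_assoc[OF h(3) g0(2) y(1)] g0(3) by simp
    also have "x \<cdot> (t \<cdot> i') = (x \<cdot> t) \<cdot> i'" using comp_assoc[OF h(3) t(1) x] by simp
    also have "(x \<cdot> t) \<cdot> i' \<boxplus> (y \<cdot> g0) \<cdot> i' = (x \<cdot> t \<boxplus> y \<cdot> g0) \<cdot> i'"
      using comp_plus_left[OF h(3) comp_hom[OF t(1) x] comp_hom[OF g0(2) y(1)]] by simp
    finally have "(x \<cdot> t \<boxplus> y \<cdot> g0) \<cdot> i' = x" by simp
    then show "\<exists>z \<in> Hom C (Cod C i') Y. z \<cdot> i' = x"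
      using plus_hom[OF comp_hom[OF t(1) x] comp_hom[OF g0(2) y(1)]] HomD[OF h(3)] by auto
  qed
qed

lemma null_proj_factoring:
  assumes "short_exact a i P p b" "P \<in> projectives C E" "x \<in> Obj C"
  shows "Null C x b \<in> proj_factoring C E x b"
proof -
  have p: "p \<in> Hom C P b" using assms(1) by (simp add: short_exact_def)
  then show ?thesis
    using proj_factoringI[OF assms(2) null_hom[OF assms(3)] p] comp_null_right[OF p assms(3)]
      Hom_objs[OF p] by simp
qed

lemma stable_retract_refl:
  assumes s: "short_exact a i P p M" "P \<in> projectives C E"
  shows "stable_retract M M"
proof -
  have M: "M \<in> Obj C" using Hom_objs s(1) by (auto simp: short_exact_def)
  have 1: "Id C M \<in> Hom C M M" using id_hom[OF M] .
  have "Id C M \<boxminus> Id C M \<cdot> Id C M = Null C M M"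
    using minus_eq_null_iff[OF 1 1] comp_id_left[OF 1] by simp
  then show ?thesis
    unfolding stable_retract_def using null_proj_factoring[OF s M]
    by (intro bexI[OF _ 1]) simp
qed

text \<open>
  By induction, each syzygy of \<open>R'\<close> is a stable retract of the corresponding syzygy of
  \<open>R\<close>.  This replaces the comparison theorem for projective resolutions.
\<close>

lemma extends_along_resolutions:
  assumes R: "proj_resolution C E M R" and R': "proj_resolution C E M' R'"
    and r: "stable_retract M' M" and e: "extends_along (fst (R n)) Y"
  shows "extends_along (fst (R' n)) Y"
proof -
  note se = proj_resolution_short_exact[OF R] and se' = proj_resolution_short_exact[OF R']
  have P: "Dom C (snd (R k)) \<in> projectives C E" "Dom C (snd (R' k)) \<in> projectives C E" for k
    using R R' by (simp_all add: proj_resolution_def)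
  have "stable_retract (Cod C (snd (R' k))) (Cod C (snd (R k)))" for k
  proof (induction k)
    case 0
    then show ?case using R R' r by (simp add: proj_resolution_def)
  next
    case (Suc k)
    have "stable_retract (Dom C (fst (R' k))) (Dom C (fst (R k)))"
      using stable_retract_of_syzygies(1)[OF se P(1) se' P(2) Suc.IH] .
    then show ?case using R R' by (simp add: proj_resolution_def)
  qed
  then show ?thesis using stable_retract_of_syzygies(2)[OF se P(1) se' P(2)] e by blast
qed

lemma proj_resolution_shift:
  assumes "proj_resolution C E M R"
  shows "proj_resolution C E (Dom C (fst (R 0))) (\<lambda>n. R (Suc n))"
  using assms by (simp add: proj_resolution_def)

end

section \<open>The stable category\<close>

lemma full_subcategory_simps [simp]:
  "Obj (full_subcategory D T) = Obj D \<inter> T"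
  "Dom (full_subcategory D T) = Dom D"
  "Cod (full_subcategory D T) = Cod D"
  "Id (full_subcategory D T) = Id D"
  "Comp (full_subcategory D T) = Comp D"
  "Plus (full_subcategory D T) = Plus D"
  "Null (full_subcategory D T) = Null D"
  by (simp_all add: full_subcategory_def)

lemma Hom_full_subcategory:
  "Hom (full_subcategory D T) a b = (if a \<in> T \<and> b \<in> T then Hom D a b else {})"
  by (auto simp: Hom_def full_subcategory_def)

lemma hom_group_full_subcategory:
  "\<lbrakk>a \<in> T; b \<in> T\<rbrakk> \<Longrightarrow> hom_group (full_subcategory D T) a b = hom_group D a b"
  by (simp add: hom_group_def Hom_full_subcategory)

lemma full_subcategory_preadditive:
  assumes "preadditive_category D"
  shows "preadditive_category (full_subcategory D T)"
proof -
  interpret preadditive_category D using assms .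
  show ?thesis
  proof (rule preadditive_category.intro)
    fix f assume "f \<in> Arr (full_subcategory D T)"
    then show "Dom (full_subcategory D T) f \<in> Obj (full_subcategory D T)"
      "Cod (full_subcategory D T) f \<in> Obj (full_subcategory D T)"
      using dom_obj cod_obj by (auto simp: full_subcategory_def)
  qed (auto simp: Hom_full_subcategory hom_group_full_subcategory hom_comm_group id_hom comp_hom
      comp_id_left comp_id_right comp_assoc comp_plus_left comp_plus_right split: if_splits)
qed

locale exact_category_with_syzygies = exact_category +
  fixes S
  assumes syzygy_choice: "syzygy_choice C E S"
begin

abbreviation "\<Omega> \<equiv> syzygy_obj C S"
abbreviation "\<iota> M \<equiv> fst (S M)"
abbreviation "\<pi> M \<equiv> snd (S M)"
abbreviation "P M \<equiv> Dom C (\<pi> M)"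
abbreviation "\<S> \<equiv> stable_category C E"
abbreviation "cls \<equiv> stable_class C E"

lemma syzygy_sequence:
  assumes "M \<in> Obj C"
  shows "short_exact (\<Omega> M) (\<iota> M) (P M) (\<pi> M) M" "P M \<in> projectives C E"
proof -
  have "(\<iota> M, \<pi> M) \<in> E" "Cod C (\<pi> M) = M" "P M \<in> projectives C E"
    using syzygy_choice assms by (simp_all add: syzygy_choice_def)
  then show "short_exact (\<Omega> M) (\<iota> M) (P M) (\<pi> M) M" "P M \<in> projectives C E"
    using short_exactI[of "\<iota> M" "\<pi> M"] by (simp_all add: syzygy_obj_def)
qed

lemma syzygy_in_Obj: "M \<in> Obj C \<Longrightarrow> \<Omega> M \<in> Obj C"
  using syzygy_sequence(1)[of M] Hom_objs by (auto simp: short_exact_def)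

text \<open>
  The arrows \<open>a \<rightarrow> b\<close> that factor through a projective are the image of the homomorphism
  that composes with \<open>\<pi> b\<close>.
\<close>

lemma proj_factoring_subgroup:
  assumes "a \<in> Obj C" "b \<in> Obj C"
  shows "subgroup (proj_factoring C E a b) (hom_group C a b)"
proof -
  note s = syzygy_sequence[OF assms(2)]
  have "\<pi> b \<in> Hom C (P b) b" using s(1) by (simp add: short_exact_def)
  then interpret group_hom "hom_group C a (P b)" "hom_group C a b" "\<lambda>k. \<pi> b \<cdot> k"
    using comp_left_group_hom assms(1) by blast
  have "proj_factoring C E a b = (\<lambda>k. \<pi> b \<cdot> k) ` Hom C a (P b)"
    using proj_factoring_iff_lift[OF s] by blast
  then show ?thesis using img_is_subgroup by simp
qed

lemma stable_class_coset:
  "f \<in> Hom C a b \<Longrightarrow> cls f = proj_factoring C E a b #>\<^bsub>hom_group C a b\<^esub> f"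
  by (simp add: stable_class_def HomD)

lemma stable_class_eq_iff:
  assumes f: "f \<in> Hom C a b" and g: "g \<in> Hom C a b"
  shows "cls f = cls g \<longleftrightarrow> f \<boxminus> g \<in> proj_factoring C E a b"
proof -
  interpret comm_group "hom_group C a b" using f hom_group_of_arrow by blast
  have sub: "subgroup (proj_factoring C E a b) (hom_group C a b)"
    using proj_factoring_subgroup Hom_objs[OF f] by blast
  have "cls f = cls g \<longleftrightarrow> f \<in> proj_factoring C E a b #>\<^bsub>hom_group C a b\<^esub> g"
    using repr_independence[OF _ _ sub, of f g] rcos_self[OF _ sub, of f] f g
    by (auto simp: stable_class_coset)
  also have "\<dots> \<longleftrightarrow> f \<boxminus> g \<in> proj_factoring C E a b"
    using subgroup.rcos_module[OF sub is_group, of g f] f g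
    by (simp add: arr_minus_def HomD[OF f])
  finally show ?thesis .
qed

lemma stable_class_mem:
  assumes f: "f \<in> Hom C a b"
  shows "f \<in> cls f"
proof -
  interpret comm_group "hom_group C a b" using f hom_group_of_arrow by blast
  show ?thesis
    using rcos_self[OF _ proj_factoring_subgroup[OF Hom_objs[OF f]]] f
    by (simp add: stable_class_coset)
qed

lemma stable_class_memD:
  assumes f: "f \<in> Hom C a b" and g: "g \<in> cls f"
  shows "g \<in> Hom C a b" "cls g = cls f"
proof -
  interpret comm_group "hom_group C a b" using f hom_group_of_arrow by blast
  note sub = proj_factoring_subgroup[OF Hom_objs[OF f]]
  have g': "g \<in> proj_factoring C E a b #>\<^bsub>hom_group C a b\<^esub> f"
    using g by (simp add: stable_class_coset[OF f])
  show 1: "g \<in> Hom C a b"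
    using subgroup.elemrcos_carrier[OF sub is_group _ g'] f by simp
  show "cls g = cls f"
    using repr_independence[OF g' _ sub] f by (simp add: stable_class_coset[OF f] stable_class_coset[OF 1])
qed

lemma rep_stable_class:
  assumes f: "f \<in> Hom C a b"
  shows "rep (cls f) \<in> Hom C a b" "cls (rep (cls f)) = cls f"
  using stable_class_memD[OF f] someI[of "\<lambda>g. g \<in> cls f", OF stable_class_mem[OF f]]
  by (simp_all add: rep_def)

lemma stable_simps [simp]:
  "Obj \<S> = Obj C" "Arr \<S> = cls ` Arr C" "Id \<S> a = cls (Id C a)"
  "Null \<S> a b = proj_factoring C E a b"
  by (simp_all add: stable_category_def)

lemma dom_cod_stable_class:
  assumes "f \<in> Arr C"
  shows "Dom \<S> (cls f) = Dom C f" "Cod \<S> (cls f) = Cod C f"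
  using rep_stable_class(1)[of f "Dom C f" "Cod C f"] assms
  by (simp_all add: stable_category_def Hom_def)

lemma Hom_stable: "Hom \<S> a b = cls ` Hom C a b"
proof -
  note * = dom_cod_stable_class
  show ?thesis
  proof (intro equalityI subsetI)
    fix F assume "F \<in> Hom \<S> a b"
    then have F: "F \<in> cls ` Arr C" "Dom \<S> F = a" "Cod \<S> F = b" by (simp_all add: Hom_def)
    then obtain f where f: "f \<in> Arr C" "F = cls f" by blast
    then have "f \<in> Hom C a b" using F * by (simp add: Hom_def)
    then show "F \<in> cls ` Hom C a b" using f(2) by blast
  next
    fix F assume "F \<in> cls ` Hom C a b"
    then obtain f where "f \<in> Hom C a b" "F = cls f" by blast
    then show "F \<in> Hom \<S> a b" using * by (simp add: Hom_def)
  qed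
qed

text \<open>
  The composite of cosets is defined by representatives; it is well defined because the
  arrows that factor through projectives form a two-sided ideal.
\<close>

lemma stable_comp:
  assumes f: "f \<in> Hom C a b" and g: "g \<in> Hom C b c"
  shows "cls g \<cdot>\<^bsub>\<S>\<^esub> cls f = cls (g \<cdot> f)"
proof -
  define f' where "f' = rep (cls f)"
  define g' where "g' = rep (cls g)"
  have f': "f' \<in> Hom C a b" "cls f' = cls f" and g': "g' \<in> Hom C b c" "cls g' = cls g"
    using rep_stable_class f g by (simp_all add: f'_def g'_def)
  have "g' \<cdot> (f' \<boxminus> f) \<in> proj_factoring C E a c"
    using proj_factoring_comp_left[OF _ g'(1)] stable_class_eq_iff[OF f'(1) f] f'(2) by blast
  then have 1: "cls (g' \<cdot> f') = cls (g' \<cdot> f)"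
    using stable_class_eq_iff[OF comp_hom[OF f'(1) g'(1)] comp_hom[OF f g'(1)]]
      comp_minus_right[OF f'(1) f g'(1)] by simp
  have "(g' \<boxminus> g) \<cdot> f \<in> proj_factoring C E a c"
    using proj_factoring_comp_right[OF _ f] stable_class_eq_iff[OF g'(1) g] g'(2) by blast
  then have "cls (g' \<cdot> f) = cls (g \<cdot> f)"
    using stable_class_eq_iff[OF comp_hom[OF f g'(1)] comp_hom[OF f g]]
      comp_minus_left[OF f g'(1) g] by simp
  with 1 show ?thesis by (simp add: stable_category_def f'_def g'_def)
qed

lemma hom_group_stable:
  assumes "a \<in> Obj C" "b \<in> Obj C"
  shows "hom_group \<S> a b = hom_group C a b Mod proj_factoring C E a b"
proof -
  have "Hom \<S> a b = rcosets\<^bsub>hom_group C a b\<^esub> proj_factoring C E a b"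
    unfolding Hom_stable RCOSETS_def using stable_class_coset by fastforce
  moreover have "Plus \<S> = set_mult (hom_group C a b)"
    by (intro ext) (auto simp: stable_category_def set_mult_def)
  ultimately show ?thesis by (simp add: hom_group_def FactGroup_def)
qed

lemma stable_plus:
  assumes f: "f \<in> Hom C a b" and g: "g \<in> Hom C a b"
  shows "cls f \<boxplus>\<^bsub>\<S>\<^esub> cls g = cls (f \<boxplus> g)"
proof -
  interpret comm_group "hom_group C a b" using f hom_group_of_arrow by blast
  interpret normal "proj_factoring C E a b" "hom_group C a b"
    using subgroup_imp_normal proj_factoring_subgroup Hom_objs[OF f] by blast
  have "Plus \<S> = set_mult (hom_group C a b)"
    by (intro ext) (auto simp: stable_category_def set_mult_def)
  then show ?thesis
    using rcos_sum[of f g] f g plus_hom[OF f g] by (simp add: stable_class_coset)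
qed

lemma stable_preadditive: "preadditive_category \<S>"
proof (rule preadditive_category.intro)
  fix F assume "F \<in> Arr \<S>"
  then obtain f where "f \<in> Arr C" "F = cls f" by auto
  then show "Dom \<S> F \<in> Obj \<S>" "Cod \<S> F \<in> Obj \<S>"
    using dom_obj cod_obj by (simp_all add: dom_cod_stable_class)
next
  fix a b assume "a \<in> Obj \<S>" "b \<in> Obj \<S>"
  then show "comm_group (hom_group \<S> a b)"
    using hom_comm_group proj_factoring_subgroup hom_group_stable comm_group.abelian_FactGroup
    by (metis stable_simps(1))
next
  fix F G H a b c d
  assume "F \<in> Hom \<S> a b" "G \<in> Hom \<S> b c" "H \<in> Hom \<S> c d"
  then obtain f g h where f: "f \<in> Hom C a b" "F = cls f" and g: "g \<in> Hom C b c" "G = cls g"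
    and h: "h \<in> Hom C c d" "H = cls h"
    by (auto simp: Hom_stable)
  show "H \<cdot>\<^bsub>\<S>\<^esub> G \<cdot>\<^bsub>\<S>\<^esub> F = H \<cdot>\<^bsub>\<S>\<^esub> (G \<cdot>\<^bsub>\<S>\<^esub> F)"
    using comp_assoc[OF f(1) g(1) h(1)] stable_comp[OF f(1) g(1)] stable_comp[OF g(1) h(1)]
      stable_comp[OF f(1) comp_hom[OF g(1) h(1)]] stable_comp[OF comp_hom[OF f(1) g(1)] h(1)]
    by (simp add: f(2) g(2) h(2))
next
  fix F F' G a b c
  assume "F \<in> Hom \<S> a b" "F' \<in> Hom \<S> a b" "G \<in> Hom \<S> b c"
  then obtain f f' g where f: "f \<in> Hom C a b" "F = cls f" and f': "f' \<in> Hom C a b" "F' = cls f'"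
    and g: "g \<in> Hom C b c" "G = cls g"
    by (auto simp: Hom_stable)
  show "G \<cdot>\<^bsub>\<S>\<^esub> (F \<boxplus>\<^bsub>\<S>\<^esub> F') = G \<cdot>\<^bsub>\<S>\<^esub> F \<boxplus>\<^bsub>\<S>\<^esub> G \<cdot>\<^bsub>\<S>\<^esub> F'"
    using comp_plus_right[OF f(1) f'(1) g(1)] stable_plus[OF f(1) f'(1)]
      stable_comp[OF plus_hom[OF f(1) f'(1)] g(1)] stable_comp[OF f(1) g(1)] stable_comp[OF f'(1) g(1)]
      stable_plus[OF comp_hom[OF f(1) g(1)] comp_hom[OF f'(1) g(1)]]
    by (simp add: f(2) f'(2) g(2))
next
  fix F G G' a b c
  assume "F \<in> Hom \<S> a b" "G \<in> Hom \<S> b c" "G' \<in> Hom \<S> b c"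
  then obtain f g g' where f: "f \<in> Hom C a b" "F = cls f" and g: "g \<in> Hom C b c" "G = cls g"
    and g': "g' \<in> Hom C b c" "G' = cls g'"
    by (auto simp: Hom_stable)
  show "(G \<boxplus>\<^bsub>\<S>\<^esub> G') \<cdot>\<^bsub>\<S>\<^esub> F = G \<cdot>\<^bsub>\<S>\<^esub> F \<boxplus>\<^bsub>\<S>\<^esub> G' \<cdot>\<^bsub>\<S>\<^esub> F"
    using comp_plus_left[OF f(1) g(1) g'(1)] stable_plus[OF g(1) g'(1)]
      stable_comp[OF f(1) plus_hom[OF g(1) g'(1)]] stable_comp[OF f(1) g(1)] stable_comp[OF f(1) g'(1)]
      stable_plus[OF comp_hom[OF f(1) g(1)] comp_hom[OF f(1) g'(1)]]
    by (simp add: f(2) g(2) g'(2))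
next
  fix F a b
  assume "F \<in> Hom \<S> a b"
  then obtain f where f: "f \<in> Hom C a b" "F = cls f" by (auto simp: Hom_stable)
  show "F \<cdot>\<^bsub>\<S>\<^esub> Id \<S> a = F" "Id \<S> b \<cdot>\<^bsub>\<S>\<^esub> F = F"
    using stable_comp[OF id_hom f(1)] stable_comp[OF f(1) id_hom] Hom_objs[OF f(1)]
      comp_id_left[OF f(1)] comp_id_right[OF f(1)] by (simp_all add: f(2))
next
  fix F G a b c
  assume "F \<in> Hom \<S> a b" "G \<in> Hom \<S> b c"
  then show "G \<cdot>\<^bsub>\<S>\<^esub> F \<in> Hom \<S> a c" by (auto simp: Hom_stable stable_comp comp_hom)
qed (simp add: Hom_stable id_hom)

section \<open>The syzygy functor on the left orthogonal of the projectives\<close>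

text \<open>Splicing the chosen sequences shows that some resolution exists to be chosen.\<close>

lemma the_resolution:
  assumes "M \<in> Obj C"
  shows "proj_resolution C E M (the_resolution C E M)"
proof -
  have O: "(\<Omega> ^^ n) M \<in> Obj C" for n
    by (induction n) (simp_all add: assms syzygy_in_Obj)
  have "S N \<in> E" "P N \<in> projectives C E" "Cod C (\<pi> N) = N" if "N \<in> Obj C" for N
    using syzygy_choice that by (simp_all add: syzygy_choice_def)
  then have "proj_resolution C E M (\<lambda>n. S ((\<Omega> ^^ n) M))"
    using O syzygy_in_Obj assms unfolding proj_resolution_def by (simp add: syzygy_obj_def)
  then show ?thesis unfolding the_resolution_def by (rule someI[of "proj_resolution C E M"])
qed

lemma left_perp_iff:
  assumes "\<Y> \<subseteq> Obj C"
  shows "M \<in> left_perp C E \<Y> \<longleftrightarrow>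
    M \<in> Obj C \<and> (\<forall>Y \<in> \<Y>. \<forall>n. extends_along (fst (the_resolution C E M n)) Y)"
proof -
  have "(\<forall>n \<ge> 1. trivial_group (Ext C E n M Y)) \<longleftrightarrow>
      (\<forall>n. extends_along (fst (the_resolution C E M n)) Y)" if "M \<in> Obj C" "Y \<in> \<Y>" for Y
  proof -
    have "(\<forall>n \<ge> 1. trivial_group (Ext C E n M Y)) \<longleftrightarrow> (\<forall>n. trivial_group (Ext C E (Suc n) M Y))"
      by (metis One_nat_def Suc_le_D le_add1 plus_1_eq_Suc)
    then show ?thesis using Ext_trivial_iff[OF the_resolution[OF that(1)]] that(2) assms by blast
  qed
  then show ?thesis unfolding left_perp_def by blast
qed

text \<open>
  The orthogonality condition speaks of the resolution that computes \<open>Ext\<close>, whose first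
  sequence need not be the chosen syzygy sequence; both end in \<open>M\<close>, so the extension
  property carries over.
\<close>

lemma left_perp_extends_along_syzygy:
  assumes Y: "\<Y> \<subseteq> Obj C" "Y \<in> \<Y>" and M: "M \<in> left_perp C E \<Y>"
  shows "extends_along (\<iota> M) Y"
proof -
  let ?R = "the_resolution C E M"
  have MO: "M \<in> Obj C" and ext: "extends_along (fst (?R 0)) Y"
    using M Y left_perp_iff by blast+
  have R: "proj_resolution C E M ?R" using the_resolution[OF MO] .
  have s: "short_exact (Dom C (fst (?R 0))) (fst (?R 0)) (Dom C (snd (?R 0))) (snd (?R 0)) M"
    "Dom C (snd (?R 0)) \<in> projectives C E"
    using proj_resolution_short_exact[OF R, of 0] R by (simp_all add: proj_resolution_def)
  note s' = syzygy_sequence[OF MO]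
  show ?thesis
    using stable_retract_of_syzygies(2)[OF s s' stable_retract_refl[OF s'] ext] .
qed

text \<open>
  Dimension shifting.  Deleting the first sequence from the resolution of \<open>M\<close> gives a resolution
  of its first syzygy, of which \<open>\<Omega> M\<close> is a stable retract.
\<close>

lemma syzygy_in_left_perp:
  assumes Y: "\<Y> \<subseteq> Obj C" and M: "M \<in> left_perp C E \<Y>"
  shows "\<Omega> M \<in> left_perp C E \<Y>"
proof -
  let ?R = "the_resolution C E M"
  have MO: "M \<in> Obj C" and ext: "\<forall>Y \<in> \<Y>. \<forall>n. extends_along (fst (?R n)) Y"
    using M Y left_perp_iff by blast+
  have R: "proj_resolution C E M ?R" using the_resolution[OF MO] .
  have s: "short_exact (Dom C (fst (?R 0))) (fst (?R 0)) (Dom C (snd (?R 0))) (snd (?R 0)) M"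
    "Dom C (snd (?R 0)) \<in> projectives C E"
    using proj_resolution_short_exact[OF R, of 0] R by (simp_all add: proj_resolution_def)
  note s' = syzygy_sequence[OF MO]
  have r: "stable_retract (\<Omega> M) (Dom C (fst (?R 0)))"
    using stable_retract_of_syzygies(1)[OF s s' stable_retract_refl[OF s']] .
  have "extends_along (fst (the_resolution C E (\<Omega> M) n)) Y" if "Y \<in> \<Y>" for Y n
    using extends_along_resolutions[OF proj_resolution_shift[OF R]
        the_resolution[OF syzygy_in_Obj[OF MO]] r, of n Y] ext that by simp
  then show ?thesis using left_perp_iff[OF Y] syzygy_in_Obj[OF MO] by blast
qed

abbreviation "syz_lift M N \<equiv> lifts_to (\<iota> M) (\<pi> M) (\<iota> N) (\<pi> N)"

lemma syz_lift_hom: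
  assumes "M \<in> Obj C" "N \<in> Obj C" "syz_lift M N f f1"
  shows "f1 \<in> Hom C (\<Omega> M) (\<Omega> N)"
  using assms(3) by (rule lifts_toE[OF _ syzygy_sequence(1)[OF assms(1)] syzygy_sequence(1)[OF assms(2)]])

text \<open>
  The syzygy map selects a representative of the class and a lift of it; any other
  representative and lift give the same class, by \<open>lift_of_proj_factoring\<close> applied to the
  differences.
\<close>

lemma syzygy_map_class:
  assumes f: "f \<in> Hom C M N" and f1: "syz_lift M N f f1"
  shows "syzygy_map C E S (cls f) = cls f1"
proof -
  have o: "M \<in> Obj C" "N \<in> Obj C" using Hom_objs f by blast+
  note s = syzygy_sequence(1)[OF o(1)] and t = syzygy_sequence(1)[OF o(2)]
  note sP = syzygy_sequence(2)[OF o(1)] and tP = syzygy_sequence(2)[OF o(2)]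
  define g where "g = rep (cls f)"
  have g: "g \<in> Hom C M N" "cls g = cls f" using rep_stable_class[OF f] by (simp_all add: g_def)
  have cd: "Cod C (\<pi> M) = M" "Cod C (\<pi> N) = N" using s t by (simp_all add: short_exact_def Hom_def)
  have lift: "syzygy_lift C S g = syz_lift M N g"
    using g(1) by (auto simp: fun_eq_iff syzygy_lift_def lifts_to_def HomD[OF g(1)] cd split: prod.splits)
  define g1 where "g1 = (SOME g1. syzygy_lift C S g g1)"
  have g1: "syz_lift M N g g1"
    using someI_ex[OF lifts_to_exists[OF s sP t g(1)]] by (simp add: g1_def lift)
  have h: "f1 \<in> Hom C (\<Omega> M) (\<Omega> N)" "g1 \<in> Hom C (\<Omega> M) (\<Omega> N)" "\<iota> M \<in> Hom C (\<Omega> M) (P M)"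
    using syz_lift_hom[OF o f1] syz_lift_hom[OF o g1] s by (simp_all add: short_exact_def)
  have "g \<boxminus> f \<in> proj_factoring C E M N" using stable_class_eq_iff[OF g(1) f] g(2) by simp
  then obtain u where "u \<in> Hom C (P M) (\<Omega> N)" "g1 \<boxminus> f1 = u \<cdot> \<iota> M"
    using lift_of_proj_factoring[OF s t tP lifts_to_minus[OF s t g1 f1]] by blast
  then have "g1 \<boxminus> f1 \<in> proj_factoring C E (\<Omega> M) (\<Omega> N)"
    using proj_factoringI[OF sP h(3)] by simp
  then have "cls g1 = cls f1" using stable_class_eq_iff[OF h(2,1)] by simp
  then show ?thesis by (simp add: syzygy_map_def g_def[symmetric] g1_def[symmetric])
qed

text \<open>The reason for fullness: extend to \<open>P M\<close>, then pass to the cokernel \<open>M\<close>.\<close>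

lemma syz_lift_surj:
  assumes o: "M \<in> Obj C" "N \<in> Obj C"
    and ext: "\<And>Q. Q \<in> projectives C E \<Longrightarrow> extends_along (\<iota> M) Q"
    and f1: "f1 \<in> Hom C (\<Omega> M) (\<Omega> N)"
  shows "\<exists>f. syz_lift M N f f1"
proof -
  note s = syzygy_sequence(1)[OF o(1)] and t = syzygy_sequence(1)[OF o(2)]
  have h: "\<iota> M \<in> Hom C (\<Omega> M) (P M)" "\<pi> M \<in> Hom C (P M) M"
    "\<iota> N \<in> Hom C (\<Omega> N) (P N)" "\<pi> N \<in> Hom C (P N) N"
    using s t by (simp_all add: short_exact_def)
  obtain f0 where f0: "f0 \<in> Hom C (P M) (P N)" "f0 \<cdot> \<iota> M = \<iota> N \<cdot> f1"
    using ext[OF syzygy_sequence(2)[OF o(2)]] comp_hom[OF f1 h(3)] HomD[OF h(1)]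
    by (auto simp: extends_along_def)
  have "(\<pi> N \<cdot> f0) \<cdot> \<iota> M = Null C (\<Omega> M) N"
    using comp_assoc[OF h(1) f0(1) h(4)] f0(2) comp_assoc[OF f1 h(3,4)] short_exact_comp[OF t]
      comp_null_left[OF f1 o(2)] by simp
  then obtain f where "f \<in> Hom C M N" "f \<cdot> \<pi> M = \<pi> N \<cdot> f0"
    using cokernel_factor[OF s comp_hom[OF f0(1) h(4)]] by blast
  then show ?thesis using lifts_toI[OF s t _ f1 f0(1)] f0(2) by metis
qed

text \<open>
  The reason for faithfulness: a factorization \<open>u \<cdot> v \<cdot> \<iota> M\<close> of \<open>f1\<close> corrects the middle
  component \<open>f0\<close> to an arrow that kills \<open>\<iota> M\<close>, without changing \<open>\<pi> N \<cdot> f0\<close>.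
\<close>

lemma syz_lift_reflects_proj_factoring:
  assumes o: "M \<in> Obj C" "N \<in> Obj C"
    and ext: "\<And>Q. Q \<in> projectives C E \<Longrightarrow> extends_along (\<iota> M) Q"
    and l: "syz_lift M N f f1" and pf: "f1 \<in> proj_factoring C E (\<Omega> M) (\<Omega> N)"
  shows "f \<in> proj_factoring C E M N"
proof -
  note s = syzygy_sequence(1)[OF o(1)] and t = syzygy_sequence(1)[OF o(2)]
  have h: "\<iota> M \<in> Hom C (\<Omega> M) (P M)" "\<pi> M \<in> Hom C (P M) M"
    "\<iota> N \<in> Hom C (\<Omega> N) (P N)" "\<pi> N \<in> Hom C (P N) N"
    using s t by (simp_all add: short_exact_def)
  obtain f0 where f: "f \<in> Hom C M N" "f1 \<in> Hom C (\<Omega> M) (\<Omega> N)" "f0 \<in> Hom C (P M) (P N)"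
    "\<pi> N \<cdot> f0 = f \<cdot> \<pi> M" "\<iota> N \<cdot> f1 = f0 \<cdot> \<iota> M"
    using l by (rule lifts_toE[OF _ s t])
  obtain k u Q where *: "f1 = u \<cdot> k" "Q \<in> projectives C E" "k \<in> Hom C (\<Omega> M) Q" "u \<in> Hom C Q (\<Omega> N)"
    using pf by (rule proj_factoringE)
  obtain v where v: "v \<in> Hom C (P M) Q" "v \<cdot> \<iota> M = k"
    using ext[OF *(2)] *(3) HomD[OF h(1)] by (auto simp: extends_along_def)
  have uv: "u \<cdot> v \<in> Hom C (P M) (\<Omega> N)" using comp_hom[OF v(1) *(4)] .
  have w: "\<iota> N \<cdot> (u \<cdot> v) \<in> Hom C (P M) (P N)" using comp_hom[OF uv h(3)] .
  have "(\<iota> N \<cdot> (u \<cdot> v)) \<cdot> \<iota> M = f0 \<cdot> \<iota> M"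
    using comp_assoc[OF h(1) uv h(3)] comp_assoc[OF h(1) v(1) *(4)] v(2) *(1) f(5) by simp
  then have "(f0 \<boxminus> \<iota> N \<cdot> (u \<cdot> v)) \<cdot> \<iota> M = Null C (\<Omega> M) (P N)"
    using comp_minus_left[OF h(1) f(3) w] minus_eq_null_iff[OF comp_hom[OF h(1) f(3)] comp_hom[OF h(1) f(3)]]
    by simp
  then obtain y where y: "y \<in> Hom C M (P N)" "y \<cdot> \<pi> M = f0 \<boxminus> \<iota> N \<cdot> (u \<cdot> v)"
    using cokernel_factor[OF s minus_hom[OF f(3) w]] by blast
  have "\<pi> N \<cdot> (\<iota> N \<cdot> (u \<cdot> v)) = Null C (P M) N"
    using comp_assoc[OF uv h(3,4)] short_exact_comp[OF t] comp_null_left[OF uv o(2)] by simp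
  then have "f \<cdot> \<pi> M = \<pi> N \<cdot> (f0 \<boxminus> \<iota> N \<cdot> (u \<cdot> v)) \<boxplus> Null C (P M) N"
    using comp_plus_right[OF minus_hom[OF f(3) w] w h(4)] minus_plus_cancel[OF f(3) w] f(4) by simp
  also have "\<dots> = \<pi> N \<cdot> (f0 \<boxminus> \<iota> N \<cdot> (u \<cdot> v))"
    using comp_hom[OF minus_hom[OF f(3) w] h(4)] null_plus plus_comm null_hom Hom_objs by metis
  also have "\<dots> = (\<pi> N \<cdot> y) \<cdot> \<pi> M" using comp_assoc[OF h(2) y(1) h(4)] y(2) by simp
  finally have "f = \<pi> N \<cdot> y"
    using epic_cancel[OF s f(1) comp_hom[OF y(1) h(4)]] by blast
  then show ?thesis
    using proj_factoringI[OF syzygy_sequence(2)[OF o(2)] y(1) h(4)] by simp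
qed

abbreviation "\<A> \<equiv> left_perp C E (projectives C E)"
abbreviation "stab\<A> \<equiv> full_subcategory \<S> \<A>"

lemma projectives_subset: "projectives C E \<subseteq> Obj C"
  by (auto simp: projectives_def)

lemma left_perp_projectives:
  assumes "M \<in> \<A>"
  shows "M \<in> Obj C" "\<Omega> M \<in> \<A>" "Q \<in> projectives C E \<Longrightarrow> extends_along (\<iota> M) Q"
  using assms syzygy_in_left_perp left_perp_extends_along_syzygy projectives_subset
  by (auto simp: left_perp_def[of C])

lemma Hom_stabA:
  "\<lbrakk>M \<in> \<A>; N \<in> \<A>\<rbrakk> \<Longrightarrow> Hom stab\<A> M N = cls ` Hom C M N"
  by (simp add: Hom_full_subcategory Hom_stable)

lemma syz_lift_exists:
  assumes "f \<in> Hom C M N"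
  obtains f1 where "syz_lift M N f f1" "f1 \<in> Hom C (\<Omega> M) (\<Omega> N)"
proof -
  have o: "M \<in> Obj C" "N \<in> Obj C" using Hom_objs assms by blast+
  show thesis
    using lifts_to_exists[OF syzygy_sequence[OF o(1)] syzygy_sequence(1)[OF o(2)] assms]
      syz_lift_hom[OF o] that by blast
qed

lemma syzygy_additive_functor: "additive_functor stab\<A> stab\<A> \<Omega> (syzygy_map C E S)"
proof (intro additive_functor.intro additive_functor_axioms.intro full_subcategory_preadditive
    stable_preadditive)
  fix a assume "a \<in> Obj stab\<A>"
  then have a: "a \<in> \<A>" "a \<in> Obj C" by simp_all
  show "\<Omega> a \<in> Obj stab\<A>" using left_perp_projectives[OF a(1)] syzygy_in_Obj[OF a(2)] by simp
  show "syzygy_map C E S (Id stab\<A> a) = Id stab\<A> (\<Omega> a)"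
    using syzygy_map_class[OF id_hom[OF a(2)] lifts_to_id[OF syzygy_sequence(1)[OF a(2)]]] by simp
next
  fix a b assume "a \<in> Obj stab\<A>" "b \<in> Obj stab\<A>"
  then have ab: "a \<in> \<A>" "b \<in> \<A>" "a \<in> Obj C" "b \<in> Obj C" by simp_all
  note A = left_perp_projectives(2)[OF ab(1)] left_perp_projectives(2)[OF ab(2)]
  show "syzygy_map C E S \<in> hom (hom_group stab\<A> a b) (hom_group stab\<A> (\<Omega> a) (\<Omega> b))"
  proof (rule homI)
    fix F assume "F \<in> carrier (hom_group stab\<A> a b)"
    then obtain f where f: "f \<in> Hom C a b" "F = cls f" using Hom_stabA[OF ab(1,2)] by auto
    obtain f1 where "syz_lift a b f f1" "f1 \<in> Hom C (\<Omega> a) (\<Omega> b)" using syz_lift_exists[OF f(1)] .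
    then show "syzygy_map C E S F \<in> carrier (hom_group stab\<A> (\<Omega> a) (\<Omega> b))"
      using syzygy_map_class[OF f(1)] f(2) Hom_stabA[OF A] by simp
  next
    fix F G assume "F \<in> carrier (hom_group stab\<A> a b)" "G \<in> carrier (hom_group stab\<A> a b)"
    then obtain f g where f: "f \<in> Hom C a b" "F = cls f" and g: "g \<in> Hom C a b" "G = cls g"
      using Hom_stabA[OF ab(1,2)] by auto
    obtain f1 where f1: "syz_lift a b f f1" "f1 \<in> Hom C (\<Omega> a) (\<Omega> b)" using syz_lift_exists[OF f(1)] .
    obtain g1 where g1: "syz_lift a b g g1" "g1 \<in> Hom C (\<Omega> a) (\<Omega> b)" using syz_lift_exists[OF g(1)] .
    have "syz_lift a b (f \<boxplus> g) (f1 \<boxplus> g1)"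
      by (rule lifts_to_plus[OF syzygy_sequence(1)[OF ab(3)] syzygy_sequence(1)[OF ab(4)] f1(1) g1(1)])
    then show "syzygy_map C E S (F \<otimes>\<^bsub>hom_group stab\<A> a b\<^esub> G) =
        syzygy_map C E S F \<otimes>\<^bsub>hom_group stab\<A> (\<Omega> a) (\<Omega> b)\<^esub> syzygy_map C E S G"
      using syzygy_map_class[OF f(1) f1(1)] syzygy_map_class[OF g(1) g1(1)]
        syzygy_map_class[OF plus_hom[OF f(1) g(1)]] stable_plus[OF f(1) g(1)]
        stable_plus[OF f1(2) g1(2)] f(2) g(2) by simp
  qed
next
  fix F G a b c assume "F \<in> Hom stab\<A> a b" "G \<in> Hom stab\<A> b c"
  then obtain f g where f: "f \<in> Hom C a b" "F = cls f" and g: "g \<in> Hom C b c" "G = cls g"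
    by (auto simp: Hom_full_subcategory Hom_stable split: if_splits)
  have o: "a \<in> Obj C" "b \<in> Obj C" "c \<in> Obj C" using Hom_objs f g by blast+
  obtain f1 where f1: "syz_lift a b f f1" "f1 \<in> Hom C (\<Omega> a) (\<Omega> b)" using syz_lift_exists[OF f(1)] .
  obtain g1 where g1: "syz_lift b c g g1" "g1 \<in> Hom C (\<Omega> b) (\<Omega> c)" using syz_lift_exists[OF g(1)] .
  have "syz_lift a c (g \<cdot> f) (g1 \<cdot> f1)"
    by (rule lifts_to_comp[OF syzygy_sequence(1)[OF o(1)] syzygy_sequence(1)[OF o(2)]
          syzygy_sequence(1)[OF o(3)] f1(1) g1(1)])
  then show "syzygy_map C E S (G \<cdot>\<^bsub>stab\<A>\<^esub> F) = syzygy_map C E S G \<cdot>\<^bsub>stab\<A>\<^esub> syzygy_map C E S F"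
    using syzygy_map_class[OF f(1) f1(1)] syzygy_map_class[OF g(1) g1(1)]
      syzygy_map_class[OF comp_hom[OF f(1) g(1)]] stable_comp[OF f(1) g(1)]
      stable_comp[OF f1(2) g1(2)] f(2) g(2) by simp
qed

lemma syzygy_full: "full_functor stab\<A> stab\<A> \<Omega> (syzygy_map C E S)"
  unfolding full_functor_def
proof (intro ballI subsetI)
  fix a b F assume "a \<in> Obj stab\<A>" "b \<in> Obj stab\<A>" and F: "F \<in> Hom stab\<A> (\<Omega> a) (\<Omega> b)"
  then have ab: "a \<in> \<A>" "b \<in> \<A>" "a \<in> Obj C" "b \<in> Obj C" by simp_all
  note A = left_perp_projectives(2)[OF ab(1)] left_perp_projectives(2)[OF ab(2)]
  obtain f1 where f1: "f1 \<in> Hom C (\<Omega> a) (\<Omega> b)" "F = cls f1" using F Hom_stabA[OF A] by auto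
  obtain f where l: "syz_lift a b f f1"
    using syz_lift_surj[OF ab(3,4) left_perp_projectives(3)[OF ab(1)] f1(1)] by blast
  from l have f: "f \<in> Hom C a b"
    by (rule lifts_toE[OF _ syzygy_sequence(1)[OF ab(3)] syzygy_sequence(1)[OF ab(4)]])
  have "F = syzygy_map C E S (cls f)" using syzygy_map_class[OF f l] f1(2) by simp
  moreover have "cls f \<in> Hom stab\<A> a b" using f Hom_stabA[OF ab(1,2)] by simp
  ultimately show "F \<in> syzygy_map C E S ` Hom stab\<A> a b" by (rule image_eqI)
qed

lemma syzygy_faithful: "faithful_functor stab\<A> (syzygy_map C E S)"
  unfolding faithful_functor_def
proof (intro ballI inj_onI)
  fix a b F G assume "a \<in> Obj stab\<A>" "b \<in> Obj stab\<A>"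
    and FG: "F \<in> Hom stab\<A> a b" "G \<in> Hom stab\<A> a b"
    and eq: "syzygy_map C E S F = syzygy_map C E S G"
  then have ab: "a \<in> \<A>" "b \<in> \<A>" "a \<in> Obj C" "b \<in> Obj C" by simp_all
  note s = syzygy_sequence(1)[OF ab(3)] and t = syzygy_sequence(1)[OF ab(4)]
  obtain f g where f: "f \<in> Hom C a b" "F = cls f" and g: "g \<in> Hom C a b" "G = cls g"
    using FG Hom_stabA[OF ab(1,2)] by auto
  obtain f1 where f1: "syz_lift a b f f1" "f1 \<in> Hom C (\<Omega> a) (\<Omega> b)" using syz_lift_exists[OF f(1)] .
  obtain g1 where g1: "syz_lift a b g g1" "g1 \<in> Hom C (\<Omega> a) (\<Omega> b)" using syz_lift_exists[OF g(1)] .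
  have "cls f1 = cls g1"
    using eq syzygy_map_class[OF f(1) f1(1)] syzygy_map_class[OF g(1) g1(1)] f(2) g(2) by simp
  then have "f1 \<boxminus> g1 \<in> proj_factoring C E (\<Omega> a) (\<Omega> b)"
    using stable_class_eq_iff[OF f1(2) g1(2)] by simp
  then have "f \<boxminus> g \<in> proj_factoring C E a b"
    using syz_lift_reflects_proj_factoring[OF ab(3,4) left_perp_projectives(3)[OF ab(1)]
        lifts_to_minus[OF s t f1(1) g1(1)]] by blast
  then show "F = G" using stable_class_eq_iff[OF f(1) g(1)] f(2) g(2) by simp
qed

end

theorem theorem4p1:
  fixes C :: "('o, 'm) preadd_cat" and E :: "('m \<times> 'm) set"
    and S :: "'o \<Rightarrow> 'm \<times> 'm" and A :: "'o set"
    and stabA :: "('o, 'm set) preadd_cat"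
  assumes "exact_category C E"
    and "enough_projectives C E"
    and "weakly_idempotent_complete C"
    and "A = left_perp C E (projectives C E)"
    and "syzygy_choice C E S"
    and "stabA = full_subcategory (stable_category C E) A"
  shows "additive_functor stabA stabA (syzygy_obj C S) (syzygy_map C E S) \<and>
         full_functor stabA stabA (syzygy_obj C S) (syzygy_map C E S) \<and>
         faithful_functor stabA (syzygy_map C E S)"
proof -
  interpret exact_category_with_syzygies C E S
    using assms(1,5)
    by (simp add: exact_category_with_syzygies_def exact_category_with_syzygies_axioms_def)
  show ?thesis
    unfolding assms(4,6) using syzygy_additive_functor syzygy_full syzygy_faithful by blast
qed

end
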